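(* Let $\boldsymbol{X}=(X_1,\ldots,X_k)\sim SME_k(\boldsymbol{\beta},\underline{\boldsymbol{Q}},\boldsymbol{\alpha})$ with $\beta_j\le\beta_k$ and $\mathbb{E}(X_j)<\infty$, $j\in I_k$, let $S=\sum_{j=1}^kX_j$, $p\in(0,1)$ and $s_p=VaR_p(S)$. Then, for each $j\in I_k$, the amount of capital allocated to the risk $X_j$ under the TVaR allocation principle, $C_j(p)=\frac1{1-p}\mathbb{E}\big(X_j\mathbb{1}_{\{S>s_p\}}\big)$, can be expressed as $$C_j(p)=\frac1{1-p}\sum_{i=1}^\infty z_{i,j}\overline{W}_i(s_p,2\beta_k),$$ where $$\begin{aligned}z_{i,j}={}&\xi_k\mu_j\,\pi_i\big(\Psi(\widetilde M_j(\underline{Q}_1)),\ldots,\Psi(\widetilde M_j(\underline{Q}_k))\big)\\&-\sum_{1\le a<b\le k}\alpha_{a,b}\gamma_a\gamma_b\Big[\varphi_{j;b}\,\pi_i\big(\Psi(\widetilde M_{j;b}(\underline{Q}_1)),\ldots,\Psi(\widetilde M_{j;b}(\underline{Q}_k))\big)+\varphi_{j;a}\,\pi_i\big(\Psi(\widetilde M_{j;a}(\underline{Q}_1)),\ldots,\Psi(\widetilde M_{j;a}(\underline{Q}_k))\big)\\&\qquad\qquad-\varphi_{j;a,b}\,\pi_i\big(\Psi(\widetilde M_{j;a,b}(\underline{Q}_1)),\ldots,\Psi(\widetilde M_{j;a,b}(\underline{Q}_k))\big)\Big],\end{aligned}$$ with $\xi_k=1+\sum_{1\le a<b\le k}\alpha_{a,b}\gamma_a\gamma_b$,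 $\mu_i=\mathbb{E}(X_i)=\frac1{\beta_i}\sum_{m=1}^\infty m\,q_{i,m}$, $\tilde\mu_i=\frac1{2\beta_i}\sum_{m=1}^\infty m\,v_{i,m}$ (where $V(\underline{Q}_i)=(v_{i,1},v_{i,2},\ldots)$), $$\varphi_{j;a,b}=\begin{cases}\mu_j&\text{if }j\notin\{a,b\},\\ \tilde\mu_j&\text{if }j\in\{a,b\},\end{cases}\qquad\varphi_{j;a}=\varphi_{j;a,a},$$ $$\widetilde M_j(\underline{Q}_i)=\begin{cases}\underline{Q}_i&\text{if }i\ne j,\\ G(\underline{Q}_i)&\text{if }i=j,\end{cases}\qquad \widetilde M_{j;a,b}(\underline{Q}_i)=\begin{cases}\underline{Q}_i&\text{if }i\notin\{j,a,b\},\\ V(\underline{Q}_i)&\text{if }i\in\{a,b\},\ i\ne j,\\ G(\underline{Q}_i)&\text{if }i=j\notin\{a,b\},\\ G(V(\underline{Q}_i))&\text{if }i=j\in\{a,b\},\end{cases}\qquad \widetilde M_{j;a}=\widetilde M_{j;a,a}.$$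
   Context: $VaR_p(Z)=\min\{x:F_Z(x)\ge p\}$ with $F_Z$ the distribution function of $Z$; $I_k=\{1,\ldots,k\}$; $\mathbb{1}$ denotes an indicator. Mixed Erlang: for $\beta>0$, $m\ge1$, $w_m(x,\beta)=\frac{\beta^mx^{m-1}e^{-\beta x}}{(m-1)!}$, $x\ge0$, and $\overline{W}_m(x,\beta)=e^{-\beta x}\sum_{j=0}^{m-1}\frac{(\beta x)^j}{j!}$. $ME(\beta,\underline{Q})$, with $\underline{Q}=(q_1,q_2,\ldots)$, $q_m\ge0$, $\sum_mq_m=1$, is the distribution on $[0,\infty)$ with pdf $\sum_{m\ge1}q_mw_m(x,\beta)$. Model $SME_k(\boldsymbol{\beta},\underline{\boldsymbol{Q}},\boldsymbol{\alpha})$, $\boldsymbol\beta=(\beta_1,\ldots,\beta_k)$, $\underline{\boldsymbol{Q}}=(\underline{Q}_1,\ldots,\underline{Q}_k)$, $\boldsymbol\alpha=(\alpha_{i,j})_{1\le i<j\le k}$: $X_j\sim ME(\beta_j,\underline{Q}_j)$ with $\underline{Q}_j=(q_{j,1},q_{j,2},\ldots)$ and pdf $f_j$, $\gamma_j=\mathbb{E}(f_j(X_j))$ (assumed to exist), $\phi_j(x)=f_j(x)-\gamma_j$, and $(X_1,\ldots,X_k)$ has joint (Sarmanov) pdf $$h(\boldsymbol{x})=\prod_{i=1}^kf_i(x_i)\Big(1+\sum_{1\le j<l\le k}\alpha_{j,l}\phi_j(x_j)\phi_l(x_l)\Big),$$ where the real numbers $\alpha_{j,l}$ are such that the last factor is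 nonnegative. Transformations of mixing vectors: - $V(\underline{Q})=(v_1,v_2,\ldots)$, $v_m=\dfrac{\sum_{i=1}^m\binom{m-1}{i-1}q_iq_{m+1-i}/2^m}{\sum_{i\ge1}\sum_{j\ge1}\binom{i+j-2}{i-1}q_iq_j/2^{i+j-1}}$; $V$ changes the associated scale parameter from $\beta$ to $2\beta$. - $G(\underline{Q})=(g_1,g_2,\ldots)$, $g_1=0$ and $g_m=\dfrac{(m-1)q_{m-1}}{\sum_{j\ge1}jq_j}$ for $m\ge2$; $G$ does not change the associated scale parameter. - $\Psi(\underline{Q})=(\psi_1,\psi_2,\ldots)$ converts a scale $b_1$ into a scale $b_2\ge b_1$: $\psi_m=\sum_{i=1}^mq_i\binom{m-1}{m-i}\big(\frac{b_1}{b_2}\big)^i\big(1-\frac{b_1}{b_2}\big)^{m-i}$ (with $0^0=1$). Here the target is always $b_2=2\beta_k$, and the source scale is $b_1=\beta_i$ when $\Psi$ is applied to $\underline{Q}_i$ or $G(\underline{Q}_i)$, and $b_1=2\beta_i$ when it is applied to $V(\underline{Q}_i)$ or $G(V(\underline{Q}_i))$. - $\pi_l(\underline{Q}_1,\ldots,\underline{Q}_m)$, $l\ge1$, are defined iteratively: $\pi_l(\underline{Q}_1)=q_{1,l}$, and $\pi_l(\underline{Q}_1,\ldots,\underline{Q}_{m+1})=0$ for $l=1,\ldots,m$, $\pi_l(\underline{Q}_1,\ldots,\underline{Q}_{m+1})=\sum_{j=m}^{l-1}\pi_j(\underline{Q}_1,\ldots,\underline{Q}_m)\,q_{m+1,l-j}$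 for $l\ge m+1$. *)

theory Defs
  imports "HOL-Probability.Probability"
begin

(* Mixing vectors (q_1, q_2, ...) and the families X_1, ..., X_k are functions on nat;
   the value at index 0 is never used.  The abbreviation is the series over m = 1, 2, ... *)

abbreviation suminf1 :: "(nat \<Rightarrow> real) \<Rightarrow> real" where
  "suminf1 f \<equiv> (\<Sum>n. f (Suc n))"

definition pairs :: "nat \<Rightarrow> (nat \<times> nat) set" where
  "pairs k = {(a, b). 1 \<le> a \<and> a < b \<and> b \<le> k}"

definition VaR :: "'a measure \<Rightarrow> ('a \<Rightarrow> real) \<Rightarrow> real \<Rightarrow> real" where
  "VaR M Z p = (LEAST x. p \<le> cdf (distr M borel Z) x)"

definition tvar_allocation ::
  "'a measure \<Rightarrow> nat \<Rightarrow> (nat \<Rightarrow> 'a \<Rightarrow> real) \<Rightarrow> real \<Rightarrow> nat \<Rightarrow> real" where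
  "tvar_allocation M k X p j =
     1 / (1 - p) *
     (\<integral>\<omega>. X j \<omega> *
        indicat_real {\<omega> \<in> space M. (\<Sum>i=1..k. X i \<omega>) > VaR M (\<lambda>\<omega>. \<Sum>i=1..k. X i \<omega>) p} \<omega> \<partial>M)"

definition mixing_vector :: "(nat \<Rightarrow> real) \<Rightarrow> bool" where
  "mixing_vector q \<longleftrightarrow> (\<forall>m\<ge>1. 0 \<le> q m) \<and> (\<lambda>n. q (Suc n)) sums 1"

(* The library's erlang_density n b has shape n + 1, so w_m(x, b) = erlang_density (m - 1) b x
   for x >= 0; it vanishes for x < 0. *)

definition me_density :: "real \<Rightarrow> (nat \<Rightarrow> real) \<Rightarrow> real \<Rightarrow> real" where
  "me_density b q x = suminf1 (\<lambda>m. q m * erlang_density (m - 1) b x)"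

definition Wbar :: "nat \<Rightarrow> real \<Rightarrow> real \<Rightarrow> real" where
  "Wbar m x b = exp (- b * x) * (\<Sum>j<m. (b * x) ^ j / fact j)"

definition me_gamma ::
  "'a measure \<Rightarrow> (nat \<Rightarrow> real) \<Rightarrow> (nat \<Rightarrow> nat \<Rightarrow> real) \<Rightarrow> (nat \<Rightarrow> 'a \<Rightarrow> real) \<Rightarrow> nat \<Rightarrow> real" where
  "me_gamma M \<beta> Q X j = (\<integral>\<omega>. me_density (\<beta> j) (Q j) (X j \<omega>) \<partial>M)"

definition sarmanov_factor ::
  "nat \<Rightarrow> (nat \<Rightarrow> real) \<Rightarrow> (nat \<Rightarrow> nat \<Rightarrow> real) \<Rightarrow> (nat \<Rightarrow> nat \<Rightarrow> real) \<Rightarrow> (nat \<Rightarrow> real)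
    \<Rightarrow> (nat \<Rightarrow> real) \<Rightarrow> real" where
  "sarmanov_factor k \<beta> Q \<alpha> \<gamma> x =
     1 + (\<Sum>(a, b)\<in>pairs k. \<alpha> a b * (me_density (\<beta> a) (Q a) (x a) - \<gamma> a)
                                 * (me_density (\<beta> b) (Q b) (x b) - \<gamma> b))"

definition sarmanov_density ::
  "nat \<Rightarrow> (nat \<Rightarrow> real) \<Rightarrow> (nat \<Rightarrow> nat \<Rightarrow> real) \<Rightarrow> (nat \<Rightarrow> nat \<Rightarrow> real) \<Rightarrow> (nat \<Rightarrow> real)
    \<Rightarrow> (nat \<Rightarrow> real) \<Rightarrow> real" where
  "sarmanov_density k \<beta> Q \<alpha> \<gamma> x =
     (\<Prod>i=1..k. me_density (\<beta> i) (Q i) (x i)) * sarmanov_factor k \<beta> Q \<alpha> \<gamma> x"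

(* Nonnegativity of the Sarmanov factor is only required on the range [0, oo)^k of the margins. *)

definition SME ::
  "'a measure \<Rightarrow> nat \<Rightarrow> (nat \<Rightarrow> real) \<Rightarrow> (nat \<Rightarrow> nat \<Rightarrow> real) \<Rightarrow> (nat \<Rightarrow> nat \<Rightarrow> real)
    \<Rightarrow> (nat \<Rightarrow> 'a \<Rightarrow> real) \<Rightarrow> bool" where
  "SME M k \<beta> Q \<alpha> X \<longleftrightarrow>
     (\<forall>j\<in>{1..k}. 0 < \<beta> j \<and> mixing_vector (Q j)
        \<and> distributed M lborel (X j) (\<lambda>x. ennreal (me_density (\<beta> j) (Q j) x))
        \<and> integrable M (\<lambda>\<omega>. me_density (\<beta> j) (Q j) (X j \<omega>)))
     \<and> (\<forall>x. (\<forall>i\<in>{1..k}. 0 \<le> x i) \<longrightarrow> 0 \<le> sarmanov_factor k \<beta> Q \<alpha> (me_gamma M \<beta> Q X) x)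
     \<and> distributed M (Pi\<^sub>M {1..k} (\<lambda>_. lborel)) (\<lambda>\<omega>. \<lambda>i\<in>{1..k}. X i \<omega>)
         (\<lambda>x. ennreal (sarmanov_density k \<beta> Q \<alpha> (me_gamma M \<beta> Q X) x))"

definition V_trans :: "(nat \<Rightarrow> real) \<Rightarrow> nat \<Rightarrow> real" where
  "V_trans q m =
     (\<Sum>i=1..m. real ((m - 1) choose (i - 1)) * q i * q (m + 1 - i) / 2 ^ m) /
     suminf1 (\<lambda>i. suminf1 (\<lambda>j. real ((i + j - 2) choose (i - 1)) * q i * q j / 2 ^ (i + j - 1)))"

definition G_trans :: "(nat \<Rightarrow> real) \<Rightarrow> nat \<Rightarrow> real" where
  "G_trans q m =
     (if m \<le> 1 then 0 else real (m - 1) * q (m - 1) / suminf1 (\<lambda>j. real j * q j))"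

definition Psi_trans :: "real \<Rightarrow> real \<Rightarrow> (nat \<Rightarrow> real) \<Rightarrow> nat \<Rightarrow> real" where
  "Psi_trans b1 b2 q m =
     (\<Sum>i=1..m. q i * real ((m - 1) choose (m - i)) * (b1 / b2) ^ i * (1 - b1 / b2) ^ (m - i))"

(* conv_coeff Q m l is pi_l(Q 1, ..., Q m), meaningful for m, l >= 1; the case m = 0 is a dummy. *)

fun conv_coeff :: "(nat \<Rightarrow> nat \<Rightarrow> real) \<Rightarrow> nat \<Rightarrow> nat \<Rightarrow> real" where
  "conv_coeff Q 0 l = 0"
| "conv_coeff Q (Suc 0) l = Q 1 l"
| "conv_coeff Q (Suc (Suc n)) l =
     (let m = Suc n in
      if l \<le> m then 0 else (\<Sum>j=m..l - 1. conv_coeff Q m j * Q (Suc m) (l - j)))"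

definition me_mean :: "real \<Rightarrow> (nat \<Rightarrow> real) \<Rightarrow> real" where
  "me_mean b q = 1 / b * suminf1 (\<lambda>m. real m * q m)"

definition M1 :: "nat \<Rightarrow> (nat \<Rightarrow> nat \<Rightarrow> real) \<Rightarrow> nat \<Rightarrow> nat \<Rightarrow> real" where
  "M1 j Q i = (if i = j then G_trans (Q i) else Q i)"

definition M2 :: "nat \<Rightarrow> nat \<Rightarrow> nat \<Rightarrow> (nat \<Rightarrow> nat \<Rightarrow> real) \<Rightarrow> nat \<Rightarrow> nat \<Rightarrow> real" where
  "M2 j a b Q i =
     (if i \<notin> {j, a, b} then Q i
      else if i \<in> {a, b} \<and> i \<noteq> j then V_trans (Q i)
      else if i = j \<and> j \<notin> {a, b} then G_trans (Q i)
      else G_trans (V_trans (Q i)))"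

(* Scale parameter attached to M2 j a b Q i: V doubles it, G leaves it unchanged. *)

definition M2_scale :: "nat \<Rightarrow> nat \<Rightarrow> (nat \<Rightarrow> real) \<Rightarrow> nat \<Rightarrow> real" where
  "M2_scale a b \<beta> i = (if i \<in> {a, b} then 2 * \<beta> i else \<beta> i)"

definition pi1 ::
  "nat \<Rightarrow> (nat \<Rightarrow> real) \<Rightarrow> (nat \<Rightarrow> nat \<Rightarrow> real) \<Rightarrow> nat \<Rightarrow> nat \<Rightarrow> real" where
  "pi1 k \<beta> Q j i = conv_coeff (\<lambda>n. Psi_trans (\<beta> n) (2 * \<beta> k) (M1 j Q n)) k i"

definition pi2 ::
  "nat \<Rightarrow> (nat \<Rightarrow> real) \<Rightarrow> (nat \<Rightarrow> nat \<Rightarrow> real) \<Rightarrow> nat \<Rightarrow> nat \<Rightarrow> nat \<Rightarrow> nat \<Rightarrow> real" where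
  "pi2 k \<beta> Q j a b i =
     conv_coeff (\<lambda>n. Psi_trans (M2_scale a b \<beta> n) (2 * \<beta> k) (M2 j a b Q n)) k i"

definition phi2 ::
  "(nat \<Rightarrow> real) \<Rightarrow> (nat \<Rightarrow> nat \<Rightarrow> real) \<Rightarrow> (nat \<Rightarrow> real) \<Rightarrow> nat \<Rightarrow> nat \<Rightarrow> nat \<Rightarrow> real" where
  "phi2 \<beta> Q \<mu> j a b = (if j \<in> {a, b} then me_mean (2 * \<beta> j) (V_trans (Q j)) else \<mu> j)"

definition xi :: "nat \<Rightarrow> (nat \<Rightarrow> nat \<Rightarrow> real) \<Rightarrow> (nat \<Rightarrow> real) \<Rightarrow> real" where
  "xi k \<alpha> \<gamma> = 1 + (\<Sum>(a, b)\<in>pairs k. \<alpha> a b * \<gamma> a * \<gamma> b)"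

(* The single-index versions are the diagonal ones: M_{j;a} = M_{j;a,a}, phi_{j;a} = phi_{j;a,a}. *)

definition z_coeff ::
  "nat \<Rightarrow> (nat \<Rightarrow> real) \<Rightarrow> (nat \<Rightarrow> nat \<Rightarrow> real) \<Rightarrow> (nat \<Rightarrow> nat \<Rightarrow> real) \<Rightarrow> (nat \<Rightarrow> real)
    \<Rightarrow> (nat \<Rightarrow> real) \<Rightarrow> nat \<Rightarrow> nat \<Rightarrow> real" where
  "z_coeff k \<beta> Q \<alpha> \<gamma> \<mu> i j =
     xi k \<alpha> \<gamma> * \<mu> j * pi1 k \<beta> Q j i
     - (\<Sum>(a, b)\<in>pairs k. \<alpha> a b * \<gamma> a * \<gamma> b *
          (phi2 \<beta> Q \<mu> j b b * pi2 k \<beta> Q j b b i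
           + phi2 \<beta> Q \<mu> j a a * pi2 k \<beta> Q j a a i
           - phi2 \<beta> Q \<mu> j a b * pi2 k \<beta> Q j a b i))"

end

theory Submission
  imports Defs
begin

text \<open>
Expanding the Sarmanov factor turns the joint density into a signed combination of products of
one-dimensional densities \<open>f\<^sub>i\<close>, in which at most two of the \<open>f\<^sub>i\<close> appear squared. Mixed Erlang
densities are stable under everything that is needed from here on. The square of \<open>f\<^sub>i\<close> is
\<open>\<gamma>\<^sub>i\<close> times the mixed Erlang density with doubled scale and mixing vector \<open>V(Q\<^sub>i)\<close>
(\<open>me_density_square\<close>), because a product of two Erlang densities is a multiple of a
third one. So the joint density is a signed mixture of densities of independent mixed Erlang vectors
(\<open>sarmanov_density_eq_mixture\<close>).

The factor \<open>x\<^sub>j\<close> of the allocated capital is absorbed into the \<open>j\<close>-th density, again by raising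
Erlang shapes: \<open>x f(x)\<close> is the mean times the density with mixing vector \<open>G\<close>
(\<open>mult_me_density\<close>). Each term of the expansion is thereby a constant times the probability that a sum of
independent mixed Erlang variables exceeds \<open>s\<^sub>p\<close>. After \<open>\<Psi>\<close> has rewritten all
densities with the largest scale \<open>2\<beta>\<^sub>k\<close>, convolution only adds Erlang shapes, so it acts on mixing
vectors as the discrete convolution \<open>\<pi>\<close>; the tail of the resulting mixture is the
series in \<open>Wbar\<close> (\<open>tail_of_independent_me_sum\<close>). Summing the terms with
their signs gives the coefficients \<open>z\<close>.

All series identities behind \<open>V\<close>, \<open>\<Psi>\<close> and \<open>\<pi>\<close> are instances of summing a nonnegative double series along its
antidiagonals. They are therefore proved for densities with values in the extended
nonnegative reals, where no convergence has to be checked, and carried over to the reals at the end.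
\<close>

section \<open>Double series of extended nonnegative reals\<close>

lemma ennreal_suminf_swap:
  fixes f :: "nat \<Rightarrow> nat \<Rightarrow> ennreal"
  shows "(\<Sum>i. \<Sum>j. f i j) = (\<Sum>j. \<Sum>i. f i j)"
proof -
  have "(\<Sum>i. \<Sum>j. f i j) = (\<integral>\<^sup>+i. (\<Sum>j. f i j) \<partial>count_space UNIV)"
    by (simp add: nn_integral_count_space_nat)
  also have "\<dots> = (\<Sum>j. \<integral>\<^sup>+i. f i j \<partial>count_space UNIV)"
    by (intro nn_integral_suminf) simp
  finally show ?thesis
    by (simp add: nn_integral_count_space_nat)
qed

lemma ennreal_suminf_diagonals:
  fixes f :: "nat \<Rightarrow> nat \<Rightarrow> ennreal"
  shows "(\<Sum>i. \<Sum>j. f i j) = (\<Sum>n. \<Sum>i\<le>n. f i (n - i))"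
proof -
  (* Row i is shifted to start at column i, so that the antidiagonals become columns. *)
  let ?h = "\<lambda>i n. if i \<le> n then f i (n - i) else 0"
  have "(\<Sum>j. f i j) = (\<Sum>n. ?h i n)" for i
    using suminf_offset[of "?h i" i] by simp
  then have "(\<Sum>i. \<Sum>j. f i j) = (\<Sum>i. \<Sum>n. ?h i n)"
    by presburger
  also have "\<dots> = (\<Sum>n. \<Sum>i. ?h i n)"
    by (rule ennreal_suminf_swap)
  also have "(\<lambda>n. \<Sum>i. ?h i n) = (\<lambda>n. \<Sum>i\<le>n. f i (n - i))"
  proof
    fix n
    have "(\<Sum>i. ?h i n) = (\<Sum>i\<in>{..n}. ?h i n)"
      by (rule suminf_finite) auto
    then show "(\<Sum>i. ?h i n) = (\<Sum>i\<le>n. f i (n - i))" by simp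
  qed
  finally show ?thesis .
qed

section \<open>Mixed Erlang densities\<close>

text \<open>
Up to the factor \<open>b\<close>, an Erlang density is a Poisson probability. The bound is uniform in the
shape, which makes the mixture series converge at every point and mixed Erlang densities bounded.
\<close>

lemma erlang_density_le_rate:
  assumes "0 < b"
  shows "erlang_density n b x \<le> b"
proof (cases "x < 0")
  case False
  have "(b * x) ^ n / fact n \<le> exp (b * x)"
  proof -
    have "(b * x) ^ n /\<^sub>R fact n \<le> exp (b * x)"
      unfolding exp_def using assms False summable_exp_generic[of "b * x"]
        sum_le_suminf[of "\<lambda>n. (b * x) ^ n /\<^sub>R fact n" "{n}"] by simp
    then show ?thesis by (simp add: divide_inverse mult.commute)
  qed
  then have "(b * x) ^ n / fact n * exp (- (b * x)) \<le> 1"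
    by (simp add: exp_minus field_simps)
  then have "b * ((b * x) ^ n / fact n * exp (- (b * x))) \<le> b * 1"
    using assms by (intro mult_left_mono) auto
  then show ?thesis
    using False by (simp add: erlang_density_def power_mult_distrib field_simps)
qed (use assms in \<open>simp add: erlang_density_def\<close>)

text \<open>
The series of \<open>me_density\<close> with values in \<open>ennreal\<close>. It makes sense for arbitrary
coefficients, so identities between mixtures can be proved before it is known that the
coefficients sum to one.
\<close>

definition enn_me_density :: "real \<Rightarrow> (nat \<Rightarrow> real) \<Rightarrow> real \<Rightarrow> ennreal" where
  "enn_me_density b q x = (\<Sum>n. ennreal (q (Suc n)) * ennreal (erlang_density n b x))"

lemma enn_me_density_measurable [measurable]: "enn_me_density b q \<in> borel_measurable borel"
  unfolding enn_me_density_def[abs_def] by measurable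

lemma me_density_measurable [measurable]: "me_density b q \<in> borel_measurable borel"
  unfolding me_density_def[abs_def] by measurable

lemma mixing_vectorD:
  assumes "mixing_vector q"
  shows "0 \<le> q (Suc n)" "summable (\<lambda>n. q (Suc n))" "(\<Sum>n. q (Suc n)) = 1"
    "(\<Sum>n. ennreal (q (Suc n))) = 1"
proof -
  show nonneg: "0 \<le> q (Suc n)" for n
    using assms by (simp add: mixing_vector_def)
  have sums: "(\<lambda>n. q (Suc n)) sums 1"
    using assms by (simp add: mixing_vector_def)
  then show "summable (\<lambda>n. q (Suc n))" "(\<Sum>n. q (Suc n)) = 1"
    by (simp_all add: sums_iff)
  show "(\<Sum>n. ennreal (q (Suc n))) = 1"
    using suminf_ennreal_eq[OF nonneg sums] by simp
qed

lemma mixing_vectorI: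
  assumes "\<And>n. 0 \<le> q (Suc n)" and "(\<Sum>n. ennreal (q (Suc n))) = 1"
  shows "mixing_vector q"
proof -
  have "summable (\<lambda>n. q (Suc n))"
    using assms by (intro summable_suminf_not_top) auto
  moreover have "(\<Sum>n. q (Suc n)) = 1"
  proof -
    have "ennreal (\<Sum>n. q (Suc n)) = ennreal 1"
      using assms suminf_ennreal[of "\<lambda>n. q (Suc n)"] by simp
    then show ?thesis
      using suminf_nonneg[OF \<open>summable _\<close>] assms(1) by (subst (asm) ennreal_inj) auto
  qed
  moreover have "0 \<le> q m" if "1 \<le> m" for m
    using assms(1)[of "m - 1"] that by simp
  ultimately show ?thesis
    unfolding mixing_vector_def by (auto simp: sums_iff)
qed

lemma me_density_sums:
  assumes "0 < b" "mixing_vector q"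
  shows "(\<lambda>n. q (Suc n) * erlang_density n b x) sums me_density b q x"
proof -
  have "summable (\<lambda>n. q (Suc n) * erlang_density n b x)"
  proof (rule summable_comparison_test'[of "\<lambda>n. q (Suc n) * b" 0])
    show "summable (\<lambda>n. q (Suc n) * b)"
      using mixing_vectorD(2)[OF assms(2)] by (rule summable_mult2)
    show "norm (q (Suc n) * erlang_density n b x) \<le> q (Suc n) * b" for n
      using assms(1) mixing_vectorD(1)[OF assms(2), of n]
      by (auto simp: abs_mult intro!: mult_left_mono erlang_density_le_rate)
  qed
  then show ?thesis
    by (simp add: me_density_def summable_sums)
qed

lemma me_density_nonneg:
  assumes "0 < b" "mixing_vector q"
  shows "0 \<le> me_density b q x"
  by (rule sums_le[OF _ sums_zero me_density_sums[OF assms]])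
    (use assms(1) mixing_vectorD(1)[OF assms(2)] in simp)

lemma me_density_neg: "x < 0 \<Longrightarrow> me_density b q x = 0"
  by (simp add: me_density_def erlang_density_def)

lemma me_density_le_rate:
  assumes "0 < b" "mixing_vector q"
  shows "me_density b q x \<le> b"
proof -
  have "(\<lambda>n. q (Suc n) * b) sums (1 * b)"
    using mixing_vectorD(2,3)[OF assms(2)] by (intro sums_mult2) (simp add: sums_iff)
  moreover have "q (Suc n) * erlang_density n b x \<le> q (Suc n) * b" for n
    using erlang_density_le_rate[OF assms(1)] mixing_vectorD(1)[OF assms(2)] by (rule mult_left_mono)
  ultimately show ?thesis
    using sums_le[OF _ me_density_sums[OF assms]] by fastforce
qed

lemma ennreal_me_density:
  assumes "0 < b" "mixing_vector q"
  shows "ennreal (me_density b q x) = enn_me_density b q x"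
  unfolding enn_me_density_def using assms(1) mixing_vectorD(1)[OF assms(2)] me_density_sums[OF assms, of x]
  by (subst suminf_ennreal_eq[symmetric, of "\<lambda>n. q (Suc n) * erlang_density n b x"])
     (auto simp: ennreal_mult)

lemma nn_integral_enn_me_density_mult:
  assumes [measurable]: "g \<in> borel_measurable borel"
  shows "(\<integral>\<^sup>+x. enn_me_density b q x * g x \<partial>lborel) =
    (\<Sum>n. ennreal (q (Suc n)) * (\<integral>\<^sup>+x. ennreal (erlang_density n b x) * g x \<partial>lborel))"
proof -
  have "(\<integral>\<^sup>+x. enn_me_density b q x * g x \<partial>lborel) =
    (\<integral>\<^sup>+x. (\<Sum>n. ennreal (q (Suc n)) * (ennreal (erlang_density n b x) * g x)) \<partial>lborel)"
    by (simp add: enn_me_density_def mult.assoc[symmetric])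
  also have "\<dots> = (\<Sum>n. \<integral>\<^sup>+x. ennreal (q (Suc n)) * (ennreal (erlang_density n b x) * g x) \<partial>lborel)"
    by (intro nn_integral_suminf) measurable
  finally show ?thesis
    by (simp add: nn_integral_cmult)
qed

lemma nn_integral_erlang_density_UNIV:
  assumes "0 < b"
  shows "(\<integral>\<^sup>+x. ennreal (erlang_density n b x) \<partial>lborel) = 1"
  using nn_integral_erlang_ith_moment[OF assms, of n 0] by simp

lemma nn_integral_enn_me_density:
  assumes "0 < b"
  shows "(\<integral>\<^sup>+x. enn_me_density b q x \<partial>lborel) = (\<Sum>n. ennreal (q (Suc n)))"
  using nn_integral_enn_me_density_mult[of "\<lambda>_. 1" b q] by (simp add: nn_integral_erlang_density_UNIV[OF assms])

text \<open>
Shape \<open>n + 1\<close> of the Erlang law has survival function \<open>Wbar (n + 1)\<close>. This needs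
\<open>0 \<le> s\<close>: for negative \<open>s\<close> the function \<open>Wbar\<close> is no longer a survival probability.
\<close>

lemma nn_integral_enn_me_density_tail:
  assumes "0 < b" "0 \<le> s" "\<And>n. 0 \<le> q (Suc n)"
  shows "(\<integral>\<^sup>+x. enn_me_density b q x * indicator {s<..} x \<partial>lborel) = (\<Sum>n. ennreal (q (Suc n) * Wbar (Suc n) s b))"
proof -
  have "(\<integral>\<^sup>+x. ennreal (erlang_density n b x) * indicator {s<..} x \<partial>lborel) = ennreal (Wbar (Suc n) s b)" for n
  proof -
    let ?I = "\<lambda>A. \<integral>\<^sup>+x. ennreal (erlang_density n b x) * indicator A x \<partial>lborel"
    have cdf: "erlang_CDF n b s = 1 - Wbar (Suc n) s b"
      using assms(2) unfolding erlang_CDF_def Wbar_def sum_distrib_left lessThan_Suc_atMost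
      by (simp add: mult.commute)
    have "1 = (\<integral>\<^sup>+x. ennreal (erlang_density n b x) * indicator {..s} x
         + ennreal (erlang_density n b x) * indicator {s<..} x \<partial>lborel)"
      unfolding nn_integral_erlang_density_UNIV[OF assms(1), of n, symmetric]
      by (intro nn_integral_cong) (auto split: split_indicator)
    also have "\<dots> = ?I {..s} + ?I {s<..}"
      by (intro nn_integral_add) measurable
    also have "\<dots> = ennreal (1 - Wbar (Suc n) s b) + ?I {s<..}"
      by (simp add: nn_integral_erlang_density[OF assms(1)] cdf)
    finally have *: "1 = ennreal (1 - Wbar (Suc n) s b) + ?I {s<..}" .
    have "0 \<le> 1 - Wbar (Suc n) s b"
      using erlang_CDF_nonneg[OF assms(1), of n s] cdf by simp
    moreover have "0 \<le> Wbar (Suc n) s b"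
      using assms unfolding Wbar_def by (intro mult_nonneg_nonneg sum_nonneg) auto
    ultimately have "ennreal (1 - Wbar (Suc n) s b) + ennreal (Wbar (Suc n) s b) = 1"
      by (subst ennreal_plus[symmetric]) auto
    with * show ?thesis
      by (metis ennreal_add_left_cancel ennreal_neq_top infinity_ennreal_def)
  qed
  then show ?thesis
    using assms nn_integral_enn_me_density_mult[of "indicator {s<..}" b q]
    by (simp add: ennreal_mult' Wbar_def sum_nonneg)
qed

section \<open>Convolution\<close>

lemma conv_coeff_eq_0:
  assumes "1 \<le> l" "l < m"
  shows "conv_coeff Q m l = 0"
  using assms by (induction Q m l rule: conv_coeff.induct) (auto simp: Let_def)

lemma conv_coeff_Suc_1: "1 \<le> m \<Longrightarrow> conv_coeff Q (Suc m) (Suc 0) = 0"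
  by (rule conv_coeff_eq_0) auto

text \<open>
The recursion of \<open>conv_coeff\<close> as a Cauchy product. Since \<open>conv_coeff Q m\<close> vanishes below
\<open>m\<close>, the sum may start at index one. The coefficients of the two factors carry shapes
\<open>i + 1\<close> and \<open>n - i + 1\<close>, whose sum \<open>n + 2\<close> is the index on the left.
\<close>

lemma conv_coeff_Suc_Suc:
  assumes "1 \<le> m"
  shows "conv_coeff Q (Suc m) (Suc (Suc n)) =
    (\<Sum>i\<le>n. conv_coeff Q m (Suc i) * Q (Suc m) (Suc (n - i)))"
proof -
  obtain m' where m: "m = Suc m'"
    using assms by (cases m) auto
  have "conv_coeff Q (Suc m) (Suc (Suc n)) =
      (\<Sum>j=m..Suc n. conv_coeff Q m j * Q (Suc m) (Suc (Suc n) - j))"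
    unfolding m by (auto simp: Let_def)
  also have "\<dots> = (\<Sum>j=Suc 0..Suc n. conv_coeff Q m j * Q (Suc m) (Suc (Suc n) - j))"
    using assms by (intro sum.mono_neutral_left) (auto simp: conv_coeff_eq_0)
  also have "\<dots> = (\<Sum>i=0..n. conv_coeff Q m (Suc i) * Q (Suc m) (Suc (Suc n) - Suc i))"
    by (rule sum.shift_bounds_cl_Suc_ivl)
  also have "\<dots> = (\<Sum>i\<le>n. conv_coeff Q m (Suc i) * Q (Suc m) (Suc (n - i)))"
    by (intro sum.cong) (auto simp: Suc_diff_le)
  finally show ?thesis .
qed

lemma conv_coeff_nonneg:
  assumes "\<And>i n. i \<in> {1..k} \<Longrightarrow> 0 \<le> Q i (Suc n)"
  shows "0 \<le> conv_coeff Q k (Suc n)"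
  using assms
proof (induction k arbitrary: n)
  case (Suc m)
  show ?case
  proof (cases "m = 0")
    case True
    then show ?thesis using Suc.prems by simp
  next
    case False
    then have m: "1 \<le> m" by simp
    show ?thesis
    proof (cases n)
      case 0
      then show ?thesis using conv_coeff_Suc_1[OF m, of Q] by simp
    next
      case (Suc n')
      then show ?thesis
        using Suc.IH Suc.prems by (auto simp: conv_coeff_Suc_Suc[OF m] intro!: sum_nonneg mult_nonneg_nonneg)
    qed
  qed
qed simp

lemma enn_me_density_mult:
  "enn_me_density b p x * enn_me_density c q y = (\<Sum>i. \<Sum>j. ennreal (p (Suc i)) * ennreal (q (Suc j)) *
    (ennreal (erlang_density i b x) * ennreal (erlang_density j c y)))"
proof -
  have "(ennreal (p (Suc i)) * ennreal (erlang_density i b x)) * enn_me_density c q y =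
    (\<Sum>j. ennreal (p (Suc i)) * ennreal (q (Suc j)) *
      (ennreal (erlang_density i b x) * ennreal (erlang_density j c y)))" for i
    unfolding enn_me_density_def ennreal_suminf_cmult[symmetric] by (simp add: mult_ac)
  then show ?thesis
    unfolding enn_me_density_def[of b p] by (simp add: ennreal_suminf_multc[symmetric] del: ennreal_suminf_multc)
qed

text \<open>
Erlang densities with a common scale form a convolution semigroup in the shape, so the double series
of the two mixtures depends on the shapes only through their sum and is summed along antidiagonals.
\<close>

lemma enn_me_density_convolution:
  assumes "0 < b"
  shows "(\<integral>\<^sup>+y. enn_me_density b p (t - y) * enn_me_density b q y \<partial>lborel) =
    (\<Sum>n. (\<Sum>i\<le>n. ennreal (p (Suc i)) * ennreal (q (Suc (n - i)))) * ennreal (erlang_density (Suc n) b t))"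
proof -
  let ?w = "\<lambda>n x. ennreal (erlang_density n b x)"
  have "(\<integral>\<^sup>+y. enn_me_density b p (t - y) * enn_me_density b q y \<partial>lborel) =
      (\<integral>\<^sup>+y. (\<Sum>i. \<Sum>j. ennreal (p (Suc i)) * ennreal (q (Suc j)) * (?w i (t - y) * ?w j y)) \<partial>lborel)"
    by (simp add: enn_me_density_mult)
  also have "\<dots> = (\<Sum>i. \<Sum>j. \<integral>\<^sup>+y. ennreal (p (Suc i)) * ennreal (q (Suc j)) * (?w i (t - y) * ?w j y) \<partial>lborel)"
    by (simp add: nn_integral_suminf)
  also have "\<dots> = (\<Sum>i. \<Sum>j. ennreal (p (Suc i)) * ennreal (q (Suc j)) * ?w (Suc (i + j)) t)"
    using fun_cong[OF convolution_erlang_density[OF assms], where x = t]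
    by (simp add: nn_integral_cmult)
  also have "\<dots> = (\<Sum>n. \<Sum>i\<le>n. ennreal (p (Suc i)) * ennreal (q (Suc (n - i))) * ?w (Suc (i + (n - i))) t)"
    by (rule ennreal_suminf_diagonals)
  also have "\<dots> = (\<Sum>n. \<Sum>i\<le>n. ennreal (p (Suc i)) * ennreal (q (Suc (n - i))) * ?w (Suc n) t)"
    by (intro suminf_cong sum.cong) auto
  finally show ?thesis
    by (simp add: sum_distrib_right)
qed

lemma enn_me_density_conv_coeff_Suc:
  assumes "0 < b" "1 \<le> m" and nonneg: "\<And>i n. i \<in> {1..Suc m} \<Longrightarrow> 0 \<le> Q i (Suc n)"
  shows "enn_me_density b (conv_coeff Q (Suc m)) t = (\<integral>\<^sup>+y. enn_me_density b (conv_coeff Q m) (t - y) * enn_me_density b (Q (Suc m)) y \<partial>lborel)"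
proof -
  let ?f = "\<lambda>n. ennreal (conv_coeff Q (Suc m) (Suc n)) * ennreal (erlang_density n b t)"
  have *: "ennreal (conv_coeff Q (Suc m) (Suc (Suc n))) =
      (\<Sum>i\<le>n. ennreal (conv_coeff Q m (Suc i)) * ennreal (Q (Suc m) (Suc (n - i))))" for n
    unfolding conv_coeff_Suc_Suc[OF assms(2)] using nonneg conv_coeff_nonneg[of m Q]
    by (subst sum_ennreal[symmetric]) (auto simp: ennreal_mult)
  have "enn_me_density b (conv_coeff Q (Suc m)) t = (\<Sum>n. ?f (n + 1)) + (\<Sum>n<1. ?f n)"
    unfolding enn_me_density_def by (rule suminf_offset) simp
  then show ?thesis
    using conv_coeff_Suc_1[OF assms(2), of Q]
    by (simp add: enn_me_density_convolution[OF assms(1)] * del: conv_coeff.simps)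
qed

section \<open>Change of scale\<close>

lemma Psi_trans_Suc:
  "Psi_trans b B q (Suc n) =
    (\<Sum>i\<le>n. q (Suc i) * real (n choose (n - i)) * (b / B) ^ Suc i * (1 - b / B) ^ (n - i))"
  unfolding Psi_trans_def One_nat_def sum.shift_bounds_cl_Suc_ivl atMost_atLeast0 by simp

lemma Psi_trans_nonneg:
  assumes "0 < b" "b \<le> B" "\<And>n. 0 \<le> q (Suc n)"
  shows "0 \<le> Psi_trans b B q (Suc n)"
  unfolding Psi_trans_Suc using assms by (intro sum_nonneg mult_nonneg_nonneg) auto

text \<open>
Write \<open>exp (- b x)\<close> as \<open>exp (- B x) exp ((B - b) x)\<close> and expand the second factor: each
power of \<open>x\<close> raises the shape at the larger scale by one. The weights are negative binomial
probabilities with success probability \<open>b / B\<close>.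
\<close>

lemma erlang_density_rescale_sums:
  assumes "0 < b" "b \<le> B"
  shows "(\<lambda>l. real ((i + l) choose l) * (b / B) ^ Suc i * (1 - b / B) ^ l * erlang_density (i + l) B x)
    sums erlang_density i b x"
proof (cases "x < 0")
  case False
  have "(\<lambda>l. ((B - b) * x) ^ l /\<^sub>R fact l) sums exp ((B - b) * x)"
    by (rule exp_converges)
  then have "(\<lambda>l. b ^ Suc i * x ^ i / fact i * exp (- B * x) * (((B - b) * x) ^ l /\<^sub>R fact l)) sums
      (b ^ Suc i * x ^ i / fact i * exp (- B * x) * exp ((B - b) * x))"
    by (rule sums_mult)
  also have "b ^ Suc i * x ^ i / fact i * exp (- B * x) * exp ((B - b) * x) = erlang_density i b x"
    using False by (simp add: erlang_density_def exp_add[symmetric] algebra_simps)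
  also have "(\<lambda>l. b ^ Suc i * x ^ i / fact i * exp (- B * x) * (((B - b) * x) ^ l /\<^sub>R fact l)) =
      (\<lambda>l. real ((i + l) choose l) * (b / B) ^ Suc i * (1 - b / B) ^ l * erlang_density (i + l) B x)"
  proof
    fix l
    (* With B - b abbreviated, field_simps leaves the powers of the difference unexpanded. *)
    define d where "d = B - b"
    have c: "real ((i + l) choose l) = fact (i + l) / (fact l * fact i)"
      by (simp add: binomial_fact)
    have r: "1 - b / B = d / B"
      using assms by (simp add: d_def field_simps)
    show "b ^ Suc i * x ^ i / fact i * exp (- B * x) * (((B - b) * x) ^ l /\<^sub>R fact l) =
      real ((i + l) choose l) * (b / B) ^ Suc i * (1 - b / B) ^ l * erlang_density (i + l) B x"
      using False assms unfolding d_def[symmetric] c r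
      by (simp add: erlang_density_def power_divide power_mult_distrib power_add field_simps)
  qed
  finally show ?thesis .
qed (simp add: erlang_density_def)

lemma enn_me_density_Psi_trans:
  assumes "0 < b" "b \<le> B" "\<And>n. 0 \<le> q (Suc n)"
  shows "enn_me_density B (Psi_trans b B q) x = enn_me_density b q x"
proof -
  let ?c = "\<lambda>i l. real ((i + l) choose l) * (b / B) ^ Suc i * (1 - b / B) ^ l"
  have c: "0 \<le> ?c i l" for i l
    using assms by simp
  have "enn_me_density b q x = (\<Sum>i. \<Sum>l. ennreal (q (Suc i) * ?c i l) * ennreal (erlang_density (i + l) B x))"
  proof -
    have "ennreal (q (Suc i)) * ennreal (erlang_density i b x) =
        (\<Sum>l. ennreal (q (Suc i) * ?c i l) * ennreal (erlang_density (i + l) B x))" for i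
    proof -
      have "ennreal (erlang_density i b x) = (\<Sum>l. ennreal (?c i l * erlang_density (i + l) B x))"
        using assms by (intro suminf_ennreal_eq[symmetric] erlang_density_rescale_sums mult_nonneg_nonneg[OF c])
          simp_all
      then have "ennreal (q (Suc i)) * ennreal (erlang_density i b x) =
          (\<Sum>l. ennreal (q (Suc i)) * ennreal (?c i l * erlang_density (i + l) B x))"
        by (simp only: ennreal_suminf_cmult)
      also have "\<dots> = (\<Sum>l. ennreal (q (Suc i) * ?c i l) * ennreal (erlang_density (i + l) B x))"
        by (intro suminf_cong, subst ennreal_mult'[OF c], subst ennreal_mult'[OF assms(3)])
          (rule mult.assoc[symmetric])
      finally show ?thesis .
    qed
    then show ?thesis by (simp add: enn_me_density_def)
  qed
  also have "\<dots> = (\<Sum>n. \<Sum>i\<le>n. ennreal (q (Suc i) * ?c i (n - i)) * ennreal (erlang_density (i + (n - i)) B x))"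
    by (rule ennreal_suminf_diagonals)
  also have "\<dots> = (\<Sum>n. (\<Sum>i\<le>n. ennreal (q (Suc i) * ?c i (n - i))) * ennreal (erlang_density n B x))"
    by (simp add: sum_distrib_right)
  also have "(\<lambda>n. \<Sum>i\<le>n. ennreal (q (Suc i) * ?c i (n - i))) = (\<lambda>n. ennreal (Psi_trans b B q (Suc n)))"
  proof
    fix n
    have "(\<Sum>i\<le>n. ennreal (q (Suc i) * ?c i (n - i))) = ennreal (\<Sum>i\<le>n. q (Suc i) * ?c i (n - i))"
      by (intro sum_ennreal mult_nonneg_nonneg[OF assms(3) c])
    then show "(\<Sum>i\<le>n. ennreal (q (Suc i) * ?c i (n - i))) = ennreal (Psi_trans b B q (Suc n))"
      by (simp add: Psi_trans_Suc mult.assoc)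
  qed
  finally show ?thesis by (simp add: enn_me_density_def)
qed

section \<open>Squares of mixed Erlang densities\<close>

text \<open>
The constant in the product of two Erlang densities, for shapes \<open>i + 1\<close> and \<open>j + 1\<close>.
These are also the weights in the numerator of \<open>V_trans\<close>, whose denominator is \<open>square_norm\<close>.
\<close>

definition square_weight :: "nat \<Rightarrow> nat \<Rightarrow> real" where
  "square_weight i j = real ((i + j) choose i) / 2 ^ (i + j + 1)"

lemma square_weight_nonneg: "0 \<le> square_weight i j"
  by (simp add: square_weight_def)

lemma square_weight_le: "square_weight i j \<le> 1"
proof -
  have "(i + j) choose i \<le> 2 ^ (i + j + 1)"
    by (rule order_trans[OF binomial_le_pow2]) simp
  then have "real ((i + j) choose i) \<le> real (2 ^ (i + j + 1))"
    by (simp only: of_nat_le_iff)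
  then show ?thesis
    unfolding square_weight_def by (simp only: of_nat_power of_nat_numeral) (simp add: divide_le_eq_1)
qed

lemma erlang_density_mult_erlang_density:
  assumes "0 < b"
  shows "erlang_density i b x * erlang_density j b x =
    b * square_weight i j * erlang_density (i + j) (2 * b) x"
proof (cases "x < 0")
  case False
  have e: "exp (- b * x) * exp (- b * x) = exp (- (2 * b) * x)"
    by (simp add: exp_add[symmetric])
  have "real ((i + j) choose i) = fact (i + j) / (fact i * fact j)"
    by (simp add: binomial_fact)
  then have "b * square_weight i j * erlang_density (i + j) (2 * b) x =
      b ^ (i + j + 2) * x ^ (i + j) * exp (- (2 * b) * x) / (fact i * fact j)"
    using False by (simp add: square_weight_def erlang_density_def power_mult_distrib field_simps)
  also have "\<dots> = erlang_density i b x * erlang_density j b x"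
    using False unfolding e[symmetric] by (simp add: erlang_density_def power_add field_simps)
  finally show ?thesis ..
qed (simp add: erlang_density_def)

definition square_norm :: "(nat \<Rightarrow> real) \<Rightarrow> real" where
  "square_norm q = (\<Sum>i. \<Sum>j. square_weight i j * q (Suc i) * q (Suc j))"

lemma V_trans_Suc:
  "V_trans q (Suc n) = (\<Sum>i\<le>n. square_weight i (n - i) * q (Suc i) * q (Suc (n - i))) / square_norm q"
proof -
  have "(\<Sum>i=1..Suc n. real ((Suc n - 1) choose (i - 1)) * q i * q (Suc n + 1 - i) / 2 ^ Suc n)
     = (\<Sum>i=0..n. real (n choose i) * q (Suc i) * q (Suc n - i) / 2 ^ Suc n)"
    unfolding One_nat_def sum.shift_bounds_cl_Suc_ivl by simp
  also have "\<dots> = (\<Sum>i\<le>n. square_weight i (n - i) * q (Suc i) * q (Suc (n - i)))"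
    unfolding atMost_atLeast0 square_weight_def
    by (intro sum.cong) (auto simp: Suc_diff_le)
  finally show ?thesis
    unfolding V_trans_def square_norm_def square_weight_def by simp
qed

text \<open>
The weights are at most one, so the double series is dominated by the product of two
convergent series. This lets the iterated real sum in the denominator of \<open>V_trans\<close> be
computed in \<open>ennreal\<close>, where its antidiagonals can be collected.
\<close>

lemma suminf_ennreal_square_weight:
  assumes "mixing_vector q"
  shows "(\<Sum>i. \<Sum>j. ennreal (square_weight i j * q (Suc i) * q (Suc j))) = ennreal (square_norm q)"
    and "0 \<le> square_norm q"
proof -
  note q = mixing_vectorD[OF assms]
  let ?a = "\<lambda>i j. square_weight i j * q (Suc i) * q (Suc j)"
  have nonneg: "0 \<le> ?a i j" for i j
    using q(1) square_weight_nonneg by simp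
  have le: "?a i j \<le> q (Suc i) * q (Suc j)" for i j
    using q(1) square_weight_le[of i j] square_weight_nonneg[of i j]
    by (simp add: mult.assoc mult_left_le_one_le)
  have inner: "summable (?a i)" for i
    by (rule summable_comparison_test'[of "\<lambda>j. q (Suc i) * q (Suc j)" 0])
      (use nonneg le q(2) in \<open>auto intro: summable_mult\<close>)
  have inner_le: "(\<Sum>j. ?a i j) \<le> q (Suc i)" for i
  proof -
    have "(\<Sum>j. ?a i j) \<le> (\<Sum>j. q (Suc i) * q (Suc j))"
      using le inner q(2) by (intro suminf_le summable_mult)
    then show ?thesis using q(2,3) by (simp add: suminf_mult)
  qed
  have outer: "summable (\<lambda>i. \<Sum>j. ?a i j)"
    by (rule summable_comparison_test'[of "\<lambda>i. q (Suc i)" 0])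
      (use nonneg inner inner_le q(2) in \<open>auto simp: suminf_nonneg\<close>)
  show "0 \<le> square_norm q"
    unfolding square_norm_def using outer inner nonneg by (intro suminf_nonneg)
  have "(\<Sum>j. ennreal (?a i j)) = ennreal (\<Sum>j. ?a i j)" for i
    using nonneg inner by (rule suminf_ennreal2)
  then have "(\<Sum>i. \<Sum>j. ennreal (?a i j)) = (\<Sum>i. ennreal (\<Sum>j. ?a i j))"
    by presburger
  also have "\<dots> = ennreal (square_norm q)"
    unfolding square_norm_def using outer inner nonneg by (intro suminf_ennreal2 suminf_nonneg)
  finally show "(\<Sum>i. \<Sum>j. ennreal (?a i j)) = ennreal (square_norm q)" .
qed

text \<open>
Multiplying out the two mixtures and collecting the antidiagonals yields the unnormalised coefficients of
\<open>V_trans q\<close>.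
\<close>

lemma enn_me_density_square:
  assumes "0 < b" "mixing_vector q"
  shows "enn_me_density b q x * enn_me_density b q x = ennreal b *
    (\<Sum>n. ennreal (\<Sum>i\<le>n. square_weight i (n - i) * q (Suc i) * q (Suc (n - i))) * ennreal (erlang_density n (2 * b) x))"
proof -
  note q = mixing_vectorD[OF assms(2)]
  let ?a = "\<lambda>i j. square_weight i j * q (Suc i) * q (Suc j)"
  have nonneg: "0 \<le> ?a i j" for i j
    using q(1) square_weight_nonneg by simp
  have *: "ennreal (q (Suc i)) * ennreal (q (Suc j)) * (ennreal (erlang_density i b x) * ennreal (erlang_density j b x))
      = ennreal b * (ennreal (?a i j) * ennreal (erlang_density (i + j) (2 * b) x))" for i j
    using q(1) assms(1) erlang_density_mult_erlang_density[OF assms(1), of i x j] nonneg square_weight_nonneg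
    by (simp add: ennreal_mult[symmetric] mult_ac)
  have "enn_me_density b q x * enn_me_density b q x = (\<Sum>i. \<Sum>j. ennreal b * (ennreal (?a i j) * ennreal (erlang_density (i + j) (2 * b) x)))"
    unfolding enn_me_density_mult * ..
  also have "\<dots> = ennreal b * (\<Sum>i. \<Sum>j. ennreal (?a i j) * ennreal (erlang_density (i + j) (2 * b) x))"
    by simp
  also have "(\<Sum>i. \<Sum>j. ennreal (?a i j) * ennreal (erlang_density (i + j) (2 * b) x)) =
      (\<Sum>n. \<Sum>i\<le>n. ennreal (?a i (n - i)) * ennreal (erlang_density (i + (n - i)) (2 * b) x))"
    by (rule ennreal_suminf_diagonals)
  also have "\<dots> = (\<Sum>n. ennreal (\<Sum>i\<le>n. ?a i (n - i)) * ennreal (erlang_density n (2 * b) x))"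
    by (intro suminf_cong, subst sum_ennreal[OF nonneg, symmetric], subst sum_distrib_right)
      (intro sum.cong, simp_all)
  finally show ?thesis .
qed

text \<open>
A vanishing norm would annihilate the diagonal terms, hence every \<open>q m\<close>, although
these sum to one. Thus the division in \<open>V_trans\<close> is a genuine one.
\<close>

lemma square_norm_pos:
  assumes "mixing_vector q"
  shows "0 < square_norm q"
proof (rule ccontr)
  assume "\<not> 0 < square_norm q"
  then have "square_norm q = 0"
    using suminf_ennreal_square_weight(2)[OF assms] by simp
  then have "(\<Sum>i. \<Sum>j. ennreal (square_weight i j * q (Suc i) * q (Suc j))) = 0"
    using suminf_ennreal_square_weight(1)[OF assms] by simp
  then have "ennreal (square_weight i i * q (Suc i) * q (Suc i)) = 0" for i
    by (simp only: suminf_eq_zero_iff[OF summableI zero_le])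
  then have "square_weight i i * (q (Suc i) * q (Suc i)) \<le> 0" for i
    by (simp add: ennreal_eq_0_iff mult.assoc)
  moreover have "0 < square_weight i i" for i
    by (simp add: square_weight_def)
  ultimately have "q (Suc i) = 0" for i
    by (metis (no_types, opaque_lifting) linorder_not_less mult_eq_0_iff mult_pos_pos not_real_square_gt_zero)
  then show False
    using mixing_vectorD(3)[OF assms] by simp
qed

lemma V_trans_nonneg:
  assumes "mixing_vector q"
  shows "0 \<le> V_trans q (Suc n)"
  unfolding V_trans_Suc using mixing_vectorD(1)[OF assms] square_norm_pos[OF assms] square_weight_nonneg
  by (intro divide_nonneg_pos sum_nonneg mult_nonneg_nonneg)

lemma mixing_vector_V_trans:
  assumes "mixing_vector q"
  shows "mixing_vector (V_trans q)"
proof (rule mixing_vectorI)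
  note q = mixing_vectorD[OF assms]
  let ?a = "\<lambda>i j. square_weight i j * q (Suc i) * q (Suc j)"
  let ?N = "\<lambda>n. \<Sum>i\<le>n. ?a i (n - i)"
  have nonneg: "0 \<le> ?a i j" for i j
    using q(1) square_weight_nonneg by simp
  have "(\<Sum>n. ennreal (?N n)) = (\<Sum>n. \<Sum>i\<le>n. ennreal (?a i (n - i)))"
    using nonneg by (simp add: sum_ennreal)
  also have "\<dots> = ennreal (square_norm q)"
    unfolding suminf_ennreal_square_weight(1)[OF assms, symmetric]
    by (rule ennreal_suminf_diagonals[symmetric])
  finally have N: "(\<Sum>n. ennreal (?N n)) = ennreal (square_norm q)" .
  have "(\<Sum>n. ennreal (V_trans q (Suc n))) = (\<Sum>n. ennreal (?N n) / ennreal (square_norm q))"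
    unfolding V_trans_Suc using nonneg square_norm_pos[OF assms]
    by (intro suminf_cong divide_ennreal[symmetric] sum_nonneg)
  also have "\<dots> = ennreal (square_norm q) / ennreal (square_norm q)"
    by (simp add: N)
  also have "\<dots> = 1"
    using square_norm_pos[OF assms] by (simp add: divide_ennreal)
  finally show "(\<Sum>n. ennreal (V_trans q (Suc n))) = 1" .
qed (rule V_trans_nonneg[OF assms])

lemma me_density_square:
  assumes "0 < b" "mixing_vector q"
  shows "me_density b q x * me_density b q x = b * square_norm q * me_density (2 * b) (V_trans q) x"
proof -
  let ?N = "\<lambda>n. \<Sum>i\<le>n. square_weight i (n - i) * q (Suc i) * q (Suc (n - i))"
  have N: "?N n = square_norm q * V_trans q (Suc n)" for n
    using square_norm_pos[OF assms(2)] by (simp add: V_trans_Suc)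
  have b2: "0 < 2 * b" using assms by simp
  note nn = me_density_nonneg[OF assms, of x] me_density_nonneg[OF b2 mixing_vector_V_trans[OF assms(2)], of x]
  have "ennreal (me_density b q x * me_density b q x) = enn_me_density b q x * enn_me_density b q x"
    using nn by (simp add: ennreal_mult ennreal_me_density[OF assms])
  also have "\<dots> = ennreal b * (ennreal (square_norm q) * enn_me_density (2 * b) (V_trans q) x)"
  proof -
    have "(\<Sum>n. ennreal (square_norm q * V_trans q (Suc n)) * ennreal (erlang_density n (2 * b) x)) =
        (\<Sum>n. ennreal (square_norm q) * (ennreal (V_trans q (Suc n)) * ennreal (erlang_density n (2 * b) x)))"
      using square_norm_pos[OF assms(2)]
      by (intro suminf_cong) (simp only: ennreal_mult'[OF less_imp_le] mult.assoc)
    then show ?thesis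
      unfolding enn_me_density_square[OF assms] N by (simp only: enn_me_density_def ennreal_suminf_cmult)
  qed
  also have "\<dots> = ennreal (b * square_norm q * me_density (2 * b) (V_trans q) x)"
    using nn square_norm_pos[OF assms(2)] assms
    by (simp add: ennreal_me_density[OF b2 mixing_vector_V_trans[OF assms(2)], symmetric] ennreal_mult mult.assoc)
  finally show ?thesis
    using nn square_norm_pos[OF assms(2)] assms by (subst (asm) ennreal_inj) auto
qed

text \<open>
This identifies \<open>\<gamma> = E(f(X))\<close> with the constant by which \<open>V_trans\<close> normalises the square of \<open>f\<close>.
\<close>

lemma integral_me_density_square:
  assumes "0 < b" "mixing_vector q"
  shows "(\<integral>x. me_density b q x * me_density b q x \<partial>lborel) = b * square_norm q"
proof (rule has_bochner_integral_integral_eq, rule has_bochner_integral_nn_integral)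
  have b2: "0 < 2 * b" using assms by simp
  note V = mixing_vector_V_trans[OF assms(2)]
  have p: "0 < b * square_norm q" using assms square_norm_pos by simp
  then show "0 \<le> b * square_norm q" by simp
  have "(\<integral>\<^sup>+x. ennreal (me_density b q x * me_density b q x) \<partial>lborel) =
      (\<integral>\<^sup>+x. ennreal (b * square_norm q) * enn_me_density (2 * b) (V_trans q) x \<partial>lborel)"
    unfolding me_density_square[OF assms] ennreal_me_density[OF b2 V, symmetric]
    using p me_density_nonneg[OF b2 V] by (simp add: ennreal_mult)
  also have "\<dots> = ennreal (b * square_norm q)"
    using mixing_vectorD(4)[OF V] by (simp add: nn_integral_cmult nn_integral_enn_me_density[OF b2])
  finally show "(\<integral>\<^sup>+x. ennreal (me_density b q x * me_density b q x) \<partial>lborel) = ennreal (b * square_norm q)" .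
qed (auto intro!: AE_I2 mult_nonneg_nonneg me_density_nonneg assms)

section \<open>Size-biased mixed Erlang densities\<close>

lemma mixing_vector_G_trans:
  assumes "mixing_vector q" "summable (\<lambda>n. real (Suc n) * q (Suc n))"
  shows "1 \<le> (\<Sum>n. real (Suc n) * q (Suc n))" "mixing_vector (G_trans q)"
proof -
  note q = mixing_vectorD[OF assms(1)]
  let ?S = "\<Sum>n. real (Suc n) * q (Suc n)"
  have "(\<Sum>n. q (Suc n)) \<le> ?S"
    using q assms(2) by (intro suminf_le) (auto simp: algebra_simps)
  then show S: "1 \<le> ?S" using q by simp
  have "(\<lambda>n. real (Suc n) * q (Suc n) / ?S) sums (?S / ?S)"
    using assms(2) by (intro sums_divide summable_sums)
  then have "(\<lambda>n. G_trans q (Suc (Suc n))) sums 1"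
    using S by (simp add: G_trans_def)
  then have "(\<lambda>n. G_trans q (Suc n)) sums (1 + G_trans q (Suc 0))"
    by (rule sums_Suc)
  moreover have "0 \<le> G_trans q m" for m
    using q(1)[of "m - 2"] S by (auto simp: G_trans_def Suc_diff_Suc numeral_2_eq_2 intro!: divide_nonneg_nonneg mult_nonneg_nonneg)
  moreover have "G_trans q (Suc 0) = 0"
    by (simp add: G_trans_def)
  ultimately show "mixing_vector (G_trans q)"
    by (simp add: mixing_vector_def)
qed

lemma me_mean_pos:
  assumes "0 < b" "mixing_vector q" "summable (\<lambda>n. real (Suc n) * q (Suc n))"
  shows "0 < me_mean b q"
  using mixing_vector_G_trans(1)[OF assms(2,3)] assms(1) unfolding me_mean_def
  by (intro mult_pos_pos) auto

text \<open>
A factor \<open>x\<close> raises the shape of an Erlang density by one: \<open>x\<close> times the density of shape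
\<open>n\<close> is \<open>n / b\<close> times the density of shape \<open>n + 1\<close>. The shift of the index explains why
\<open>G_trans q\<close> vanishes at one.
\<close>

lemma mult_me_density:
  assumes "0 < b" "mixing_vector q" "summable (\<lambda>n. real (Suc n) * q (Suc n))"
  shows "x * me_density b q x = me_mean b q * me_density b (G_trans q) x"
proof -
  let ?S = "\<Sum>n. real (Suc n) * q (Suc n)"
  have S: "1 \<le> ?S" using mixing_vector_G_trans(1)[OF assms(2,3)] .
  have mean: "me_mean b q = ?S / b"
    by (simp add: me_mean_def)
  have "(\<lambda>n. G_trans q (Suc n) * erlang_density n b x) sums me_density b (G_trans q) x"
    by (rule me_density_sums[OF assms(1) mixing_vector_G_trans(2)[OF assms(2,3)]])
  then have "(\<lambda>n. G_trans q (Suc (Suc n)) * erlang_density (Suc n) b x) sums me_density b (G_trans q) x"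
    by (subst sums_Suc_iff) (simp add: G_trans_def)
  then have "(\<lambda>n. ?S / b * (G_trans q (Suc (Suc n)) * erlang_density (Suc n) b x)) sums
      (?S / b * me_density b (G_trans q) x)"
    by (rule sums_mult)
  also have "(\<lambda>n. ?S / b * (G_trans q (Suc (Suc n)) * erlang_density (Suc n) b x)) =
      (\<lambda>n. x * (q (Suc n) * erlang_density n b x))"
  proof
    fix n
    have w: "real (Suc n) * erlang_density (Suc n) b x = b * x * erlang_density n b x"
      by (simp add: erlang_density_def field_simps del: of_nat_Suc)
    have g: "?S * G_trans q (Suc (Suc n)) = real (Suc n) * q (Suc n)"
      using S by (simp add: G_trans_def)
    have "?S / b * (G_trans q (Suc (Suc n)) * erlang_density (Suc n) b x) =
        (?S * G_trans q (Suc (Suc n))) * erlang_density (Suc n) b x / b"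
      by simp
    also have "\<dots> = q (Suc n) * (real (Suc n) * erlang_density (Suc n) b x) / b"
      unfolding g by simp
    also have "\<dots> = x * (q (Suc n) * erlang_density n b x)"
      unfolding w using assms(1) by simp
    finally show "?S / b * (G_trans q (Suc (Suc n)) * erlang_density (Suc n) b x) =
        x * (q (Suc n) * erlang_density n b x)" .
  qed
  finally show ?thesis
    using sums_mult[OF me_density_sums[OF assms(1,2)], of x x] sums_unique2 unfolding mean by blast
qed

lemma nn_integral_mult_enn_me_density:
  assumes "0 < b" 
  shows "(\<integral>\<^sup>+x. enn_me_density b q x * ennreal x \<partial>lborel) = (\<Sum>n. ennreal (q (Suc n)) * ennreal (real (Suc n) / b))"
proof -
  have "(\<integral>\<^sup>+x. ennreal (erlang_density n b x) * ennreal x \<partial>lborel) = ennreal (real (Suc n) / b)" for n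
    using nn_integral_erlang_ith_moment[OF assms, of n 1] assms by (simp add: ennreal_mult')
  then show ?thesis
    by (simp add: nn_integral_enn_me_density_mult)
qed

text \<open>
Finiteness of the mean in its two forms: a condition on the mixing vector, as \<open>G_trans\<close> needs it, and
one on the density, as an integrable random variable provides it.
\<close>

lemma summable_mean_iff:
  assumes "0 < b" "mixing_vector q"
  shows "summable (\<lambda>n. real (Suc n) * q (Suc n)) \<longleftrightarrow> (\<integral>\<^sup>+x. enn_me_density b q x * ennreal x \<partial>lborel) \<noteq> \<top>"
proof -
  have nn: "0 \<le> q (Suc n) * (real (Suc n) / b)" for n
    using assms mixing_vectorD(1)[OF assms(2)] by simp
  have *: "(\<integral>\<^sup>+x. enn_me_density b q x * ennreal x \<partial>lborel) = (\<Sum>n. ennreal (q (Suc n) * (real (Suc n) / b)))"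
    unfolding nn_integral_mult_enn_me_density[OF assms(1)]
    by (intro suminf_cong ennreal_mult'[OF mixing_vectorD(1)[OF assms(2)], symmetric])
  have "summable (\<lambda>n. real (Suc n) * q (Suc n)) \<longleftrightarrow> summable (\<lambda>n. q (Suc n) * (real (Suc n) / b))"
    using summable_cmult_iff[of "1 / b" "\<lambda>n. real (Suc n) * q (Suc n)"] assms(1)
    by (simp add: mult.commute del: of_nat_Suc summable_cmult_iff)
  also have "\<dots> \<longleftrightarrow> (\<Sum>n. ennreal (q (Suc n) * (real (Suc n) / b))) \<noteq> \<top>"
    by (rule iffI[OF ennreal_suminf_neq_top[OF _ nn] summable_suminf_not_top[OF nn]])
  finally show ?thesis unfolding * .
qed

lemma integral_mult_me_density:
  assumes "0 < b" "mixing_vector q" "summable (\<lambda>n. real (Suc n) * q (Suc n))"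
  shows "(\<integral>x. me_density b q x * x \<partial>lborel) = me_mean b q"
proof (rule has_bochner_integral_integral_eq, rule has_bochner_integral_nn_integral)
  note G = mixing_vector_G_trans(2)[OF assms(2,3)]
  have *: "me_density b q x * x = me_mean b q * me_density b (G_trans q) x" for x
    using mult_me_density[OF assms, of x] by (simp add: mult.commute)
  show "AE x in lborel. 0 \<le> me_density b q x * x" "0 \<le> me_mean b q"
    using me_density_nonneg[OF assms(1) G] me_mean_pos[OF assms] unfolding * by auto
  show "(\<integral>\<^sup>+x. ennreal (me_density b q x * x) \<partial>lborel) = ennreal (me_mean b q)"
    using me_density_nonneg[OF assms(1) G] me_mean_pos[OF assms] mixing_vectorD(4)[OF G] unfolding *
    by (simp add: ennreal_mult nn_integral_cmult ennreal_me_density[OF assms(1) G] nn_integral_enn_me_density[OF assms(1)])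
qed simp

text \<open>
Since \<open>f\<close> is bounded, \<open>x f(x)\<^sup>2\<close> is dominated by a multiple of \<open>x f(x)\<close>. The scale can be taken to be one,
because the claim concerns the mixing vector only.
\<close>

lemma summable_mean_V_trans:
  assumes "mixing_vector q" "summable (\<lambda>n. real (Suc n) * q (Suc n))"
  shows "summable (\<lambda>n. real (Suc n) * V_trans q (Suc n))"
proof -
  have one: "0 < (1::real)" and two: "0 < (2::real)" by simp_all
  note V = mixing_vector_V_trans[OF assms(1)]
  let ?f = "me_density 1 q"
  have "enn_me_density 2 (V_trans q) x * ennreal x \<le> ennreal (1 / square_norm q) * (enn_me_density 1 q x * ennreal x)" for x
  proof (cases "0 \<le> x")
    case True
    have "square_norm q * me_density 2 (V_trans q) x = ?f x * ?f x"
      using me_density_square[OF one assms(1), of x] by simp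
    also have "\<dots> \<le> 1 * ?f x"
      using me_density_nonneg[OF one assms(1), of x] me_density_le_rate[OF one assms(1), of x]
      by (intro mult_right_mono)
    finally have "square_norm q * me_density 2 (V_trans q) x * x \<le> ?f x * x"
      using True by (intro mult_right_mono) simp_all
    then have "me_density 2 (V_trans q) x * x \<le> (1 / square_norm q) * (?f x * x)"
      using square_norm_pos[OF assms(1)] by (simp add: field_simps)
    then have "ennreal (me_density 2 (V_trans q) x * x) \<le> ennreal ((1 / square_norm q) * (?f x * x))"
      by (rule ennreal_leI)
    also have "ennreal ((1 / square_norm q) * (?f x * x)) = ennreal (1 / square_norm q) * (enn_me_density 1 q x * ennreal x)"
      using True square_norm_pos[OF assms(1)] me_density_nonneg[OF one assms(1), of x]
      by (simp only: ennreal_mult mult_nonneg_nonneg divide_nonneg_pos zero_le_one ennreal_me_density[OF one assms(1)])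
    also have "ennreal (me_density 2 (V_trans q) x * x) = enn_me_density 2 (V_trans q) x * ennreal x"
      using True me_density_nonneg[OF two V, of x]
      by (simp only: ennreal_mult ennreal_me_density[OF two V])
    finally show ?thesis .
  qed (simp add: ennreal_neg)
  then have "(\<integral>\<^sup>+x. enn_me_density 2 (V_trans q) x * ennreal x \<partial>lborel) \<le>
      ennreal (1 / square_norm q) * (\<integral>\<^sup>+x. enn_me_density 1 q x * ennreal x \<partial>lborel)"
    by (subst nn_integral_cmult[symmetric]) (auto intro!: nn_integral_mono)
  also have "\<dots> < \<top>"
    using assms(2) unfolding summable_mean_iff[OF one assms(1)]
    by (simp add: ennreal_mult_less_top less_top)
  finally show ?thesis
    unfolding summable_mean_iff[OF two V] by simp
qed

section \<open>Sums of independent mixed Erlang variables\<close>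

text \<open>
The law of the sum under a product density. The test function \<open>g\<close> is arbitrary because
integrating out the last coordinate replaces \<open>g\<close> by its translates.
\<close>

lemma nn_integral_PiM_enn_me_density:
  assumes "0 < B" "1 \<le> k" and "\<And>i n. i \<in> {1..k} \<Longrightarrow> 0 \<le> Q i (Suc n)"
    and "g \<in> borel_measurable borel"
  shows "(\<integral>\<^sup>+x. (\<Prod>i=1..k. enn_me_density B (Q i) (x i)) * g (\<Sum>i=1..k. x i) \<partial>Pi\<^sub>M {1..k} (\<lambda>_. lborel)) =
    (\<integral>\<^sup>+t. enn_me_density B (conv_coeff Q k) t * g t \<partial>lborel)"
  using assms(2-)
proof (induction k arbitrary: g rule: dec_induct)
  case base
  interpret product_sigma_finite "\<lambda>_::nat. lborel :: real measure" by standard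
  have [measurable]: "g \<in> borel_measurable borel" by fact
  have "(\<integral>\<^sup>+x. enn_me_density B (Q 1) (x 1) * g (x 1) \<partial>Pi\<^sub>M {1::nat} (\<lambda>_. lborel)) =
      (\<integral>\<^sup>+t. enn_me_density B (Q 1) t * g t \<partial>lborel)"
    by (rule product_nn_integral_singleton[of "\<lambda>t. enn_me_density B (Q 1) t * g t"]) measurable
  moreover have "enn_me_density B (conv_coeff Q 1) = enn_me_density B (Q 1)"
    by (simp add: enn_me_density_def fun_eq_iff)
  ultimately show ?case by simp
next
  case (step k)
  interpret product_sigma_finite "\<lambda>_::nat. lborel :: real measure" by standard
  have [measurable]: "g \<in> borel_measurable borel" by fact
  let ?P = "\<lambda>x. \<Prod>i=1..k. enn_me_density B (Q i) (x i)"
  let ?q = "enn_me_density B (Q (Suc k))" and ?c = "enn_me_density B (conv_coeff Q k)"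
  have set: "{1..Suc k} = insert (Suc k) {1..k}"
    using atLeastAtMostSuc_conv[of 1 k] by simp
  have "(\<integral>\<^sup>+x. (\<Prod>i=1..Suc k. enn_me_density B (Q i) (x i)) * g (\<Sum>i=1..Suc k. x i) \<partial>Pi\<^sub>M {1..Suc k} (\<lambda>_. lborel)) =
    (\<integral>\<^sup>+y. (\<integral>\<^sup>+x. (\<Prod>i=1..Suc k. enn_me_density B (Q i) ((x(Suc k := y)) i)) * g (\<Sum>i=1..Suc k. (x(Suc k := y)) i)
      \<partial>Pi\<^sub>M {1..k} (\<lambda>_. lborel)) \<partial>lborel)"
    unfolding set by (subst product_nn_integral_insert_rev) (simp_all, measurable)
  also have "\<dots> = (\<integral>\<^sup>+y. (\<integral>\<^sup>+x. ?q y * (?P x * g (y + (\<Sum>i=1..k. x i))) \<partial>Pi\<^sub>M {1..k} (\<lambda>_. lborel)) \<partial>lborel)"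
  proof (intro nn_integral_cong)
    fix x :: "nat \<Rightarrow> real" and y :: real
    have "(\<Prod>i=1..k. enn_me_density B (Q i) ((x(Suc k := y)) i)) = ?P x" "(\<Sum>i=1..k. (x(Suc k := y)) i) = (\<Sum>i=1..k. x i)"
      by (intro prod.cong sum.cong; simp)+
    then have "(\<Prod>i=1..Suc k. enn_me_density B (Q i) ((x(Suc k := y)) i)) = ?q y * ?P x"
      "(\<Sum>i=1..Suc k. (x(Suc k := y)) i) = y + (\<Sum>i=1..k. x i)"
      unfolding set by simp_all
    then show "(\<Prod>i=1..Suc k. enn_me_density B (Q i) ((x(Suc k := y)) i)) * g (\<Sum>i=1..Suc k. (x(Suc k := y)) i) =
        ?q y * (?P x * g (y + (\<Sum>i=1..k. x i)))"
      by (simp only: mult.assoc)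
  qed
  also have "\<dots> = (\<integral>\<^sup>+y. ?q y * (\<integral>\<^sup>+x. ?P x * g (y + (\<Sum>i=1..k. x i)) \<partial>Pi\<^sub>M {1..k} (\<lambda>_. lborel)) \<partial>lborel)"
    by (intro nn_integral_cong nn_integral_cmult) measurable
  also have "\<dots> = (\<integral>\<^sup>+y. ?q y * (\<integral>\<^sup>+t. ?c t * g (y + t) \<partial>lborel) \<partial>lborel)"
  proof -
    have "(\<integral>\<^sup>+x. ?P x * g (y + (\<Sum>i=1..k. x i)) \<partial>Pi\<^sub>M {1..k} (\<lambda>_. lborel)) = (\<integral>\<^sup>+t. ?c t * g (y + t) \<partial>lborel)" for y
      using step.IH[of "\<lambda>t. g (y + t)"] step.prems(1) by simp
    then show ?thesis by presburger
  qed
  also have "\<dots> = (\<integral>\<^sup>+y. ?q y * (\<integral>\<^sup>+t. ?c (t - y) * g t \<partial>lborel) \<partial>lborel)"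
  proof -
    have "(\<integral>\<^sup>+t. ?c (t - y) * g t \<partial>lborel) = (\<integral>\<^sup>+t. ?c t * g (y + t) \<partial>lborel)" for y
      using nn_integral_real_affine[of "\<lambda>t. ?c (t - y) * g t" 1 y] by simp
    then show ?thesis by presburger
  qed
  also have "\<dots> = (\<integral>\<^sup>+y. (\<integral>\<^sup>+t. ?c (t - y) * ?q y * g t \<partial>lborel) \<partial>lborel)"
    by (simp add: nn_integral_cmult[symmetric] mult_ac)
  also have "\<dots> = (\<integral>\<^sup>+t. (\<integral>\<^sup>+y. ?c (t - y) * ?q y * g t \<partial>lborel) \<partial>lborel)"
    by (rule lborel_pair.Fubini') measurable
  also have "\<dots> = (\<integral>\<^sup>+t. (\<integral>\<^sup>+y. ?c (t - y) * ?q y \<partial>lborel) * g t \<partial>lborel)"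
    by (simp add: nn_integral_multc)
  also have "\<dots> = (\<integral>\<^sup>+t. enn_me_density B (conv_coeff Q (Suc k)) t * g t \<partial>lborel)"
    using enn_me_density_conv_coeff_Suc[OF assms(1) step.hyps(1), of Q] step.prems(1) by simp
  finally show ?case .
qed

text \<open>
With \<open>g\<close> the indicator of \<open>{s<..}\<close> the preceding lemma computes the tail probability. With
\<open>g = 1\<close> it shows that the coefficients \<open>c\<close> have total mass one, hence that the series converges.
\<close>

lemma tail_of_independent_me_sum:
  fixes R :: "nat \<Rightarrow> nat \<Rightarrow> real"
  assumes "1 \<le> k" "0 \<le> s"
    and b: "\<And>i. i \<in> {1..k} \<Longrightarrow> 0 < b i \<and> b i \<le> B"
    and R: "\<And>i. i \<in> {1..k} \<Longrightarrow> mixing_vector (R i)"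
  defines "c \<equiv> conv_coeff (\<lambda>n. Psi_trans (b n) B (R n)) k"
  shows "summable (\<lambda>n. c (Suc n) * Wbar (Suc n) s B)"
    and "has_bochner_integral (Pi\<^sub>M {1..k} (\<lambda>_. lborel))
      (\<lambda>x. indicat_real {s<..} (\<Sum>i=1..k. x i) * (\<Prod>i=1..k. me_density (b i) (R i) (x i)))
      (\<Sum>n. c (Suc n) * Wbar (Suc n) s B)"
proof -
  interpret product_sigma_finite "\<lambda>_::nat. lborel :: real measure" by standard
  let ?N = "Pi\<^sub>M {1..k} (\<lambda>_::nat. lborel :: real measure)"
  let ?f = "\<lambda>x. \<Prod>i=1..k. me_density (b i) (R i) (x i)"
  let ?t = "\<lambda>n. c (Suc n) * Wbar (Suc n) s B"
  have B: "0 < B" using b[of 1] assms(1) by auto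
  have Psi: "0 \<le> Psi_trans (b i) B (R i) (Suc n)" if "i \<in> {1..k}" for i n
    using b[OF that] mixing_vectorD(1)[OF R[OF that]] by (intro Psi_trans_nonneg) auto
  have c: "0 \<le> c (Suc n)" for n
    unfolding c_def using Psi by (intro conv_coeff_nonneg)
  have f: "0 \<le> ?f x" for x
    using b R by (intro prod_nonneg ballI me_density_nonneg) auto
  have enn_me_density: "ennreal (?f x) = (\<Prod>i=1..k. enn_me_density B (Psi_trans (b i) B (R i)) (x i))" for x
  proof -
    have "ennreal (?f x) = (\<Prod>i=1..k. ennreal (me_density (b i) (R i) (x i)))"
      using b R by (intro prod_ennreal[symmetric] me_density_nonneg) auto
    also have "\<dots> = (\<Prod>i=1..k. enn_me_density B (Psi_trans (b i) B (R i)) (x i))"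
    proof (intro prod.cong refl)
      fix i assume i: "i \<in> {1..k}"
      show "ennreal (me_density (b i) (R i) (x i)) = enn_me_density B (Psi_trans (b i) B (R i)) (x i)"
        using b[OF i] ennreal_me_density[OF _ R[OF i]] mixing_vectorD(1)[OF R[OF i]]
        by (simp add: enn_me_density_Psi_trans)
    qed
    finally show ?thesis .
  qed
  have key: "(\<integral>\<^sup>+x. ennreal (?f x) * g (\<Sum>i=1..k. x i) \<partial>?N) = (\<integral>\<^sup>+t. enn_me_density B c t * g t \<partial>lborel)"
    if "g \<in> borel_measurable borel" for g :: "real \<Rightarrow> ennreal"
    unfolding enn_me_density c_def by (rule nn_integral_PiM_enn_me_density[where Q = "\<lambda>n. Psi_trans (b n) B (R n)", OF B assms(1) Psi that])
  have total: "(\<integral>\<^sup>+t. enn_me_density B c t \<partial>lborel) = 1"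
  proof -
    have "(\<integral>\<^sup>+t. enn_me_density B c t \<partial>lborel) = (\<integral>\<^sup>+x. ennreal (?f x) \<partial>?N)"
      using key[of "\<lambda>_. 1"] by simp
    also have "\<dots> = (\<integral>\<^sup>+x. (\<Prod>i=1..k. ennreal (me_density (b i) (R i) (x i))) \<partial>?N)"
      using b R by (intro nn_integral_cong prod_ennreal[symmetric] me_density_nonneg) auto
    also have "\<dots> = (\<Prod>i=1..k. \<integral>\<^sup>+t. ennreal (me_density (b i) (R i) t) \<partial>lborel)"
      by (rule product_nn_integral_prod) auto
    also have "\<dots> = 1"
      using b R by (intro prod.neutral) (simp add: ennreal_me_density nn_integral_enn_me_density mixing_vectorD(4))
    finally show ?thesis .
  qed
  have W: "0 \<le> ?t n" for n
    unfolding Wbar_def using c assms(2) B by (intro mult_nonneg_nonneg sum_nonneg) auto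
  have tail: "(\<integral>\<^sup>+t. enn_me_density B c t * indicator {s<..} t \<partial>lborel) = (\<Sum>n. ennreal (?t n))"
    by (rule nn_integral_enn_me_density_tail[where q = c, OF B assms(2) c])
  have "(\<integral>\<^sup>+t. enn_me_density B c t * indicator {s<..} t \<partial>lborel) \<le> (\<integral>\<^sup>+t. enn_me_density B c t \<partial>lborel)"
    by (intro nn_integral_mono) (auto split: split_indicator)
  then have fin: "(\<Sum>n. ennreal (?t n)) \<noteq> \<top>"
    unfolding tail total by (auto simp: top_unique)
  show summable: "summable ?t"
    using W fin by (rule summable_suminf_not_top)
  show "has_bochner_integral ?N (\<lambda>x. indicat_real {s<..} (\<Sum>i=1..k. x i) * ?f x) (\<Sum>n. ?t n)"
  proof (rule has_bochner_integral_nn_integral)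
    show "0 \<le> (\<Sum>n. ?t n)"
      using summable W by (rule suminf_nonneg)
    show "AE x in ?N. 0 \<le> indicat_real {s<..} (\<Sum>i=1..k. x i) * ?f x"
      using f by simp
    have "(\<integral>\<^sup>+x. ennreal (indicat_real {s<..} (\<Sum>i=1..k. x i) * ?f x) \<partial>?N) =
        (\<integral>\<^sup>+x. ennreal (?f x) * indicator {s<..} (\<Sum>i=1..k. x i) \<partial>?N)"
      by (intro nn_integral_cong) (simp split: split_indicator)
    also have "\<dots> = (\<Sum>n. ennreal (?t n))"
      unfolding tail[symmetric] by (rule key) simp
    also have "\<dots> = ennreal (\<Sum>n. ?t n)"
      using W summable by (rule suminf_ennreal2)
    finally show "(\<integral>\<^sup>+x. ennreal (indicat_real {s<..} (\<Sum>i=1..k. x i) * ?f x) \<partial>?N) = ennreal (\<Sum>n. ?t n)" .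
  qed measurable
qed

text \<open>
The factor \<open>x j\<close> is absorbed into the \<open>j\<close>-th density, which leaves a tail
probability of an independent vector with size-biased \<open>j\<close>-th component.
\<close>

lemma tail_allocation_of_independent_me:
  fixes R :: "nat \<Rightarrow> nat \<Rightarrow> real"
  assumes "j \<in> {1..k}" "0 \<le> s"
    and b: "\<And>i. i \<in> {1..k} \<Longrightarrow> 0 < b i \<and> b i \<le> B"
    and R: "\<And>i. i \<in> {1..k} \<Longrightarrow> mixing_vector (R i)"
    and mean: "summable (\<lambda>n. real (Suc n) * R j (Suc n))"
  defines "c \<equiv> conv_coeff (\<lambda>n. Psi_trans (b n) B (if n = j then G_trans (R n) else R n)) k"
  shows "summable (\<lambda>n. c (Suc n) * Wbar (Suc n) s B)"
    and "has_bochner_integral (Pi\<^sub>M {1..k} (\<lambda>_. lborel))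
      (\<lambda>x. x j * indicat_real {s<..} (\<Sum>i=1..k. x i) * (\<Prod>i=1..k. me_density (b i) (R i) (x i)))
      (me_mean (b j) (R j) * (\<Sum>n. c (Suc n) * Wbar (Suc n) s B))"
proof -
  let ?R = "\<lambda>n. if n = j then G_trans (R n) else R n"
  have k: "1 \<le> k" using assms(1) by simp
  have R': "mixing_vector (?R i)" if "i \<in> {1..k}" for i
    using R[OF that] mixing_vector_G_trans(2)[OF R mean] assms(1) by simp
  note T = tail_of_independent_me_sum[of k s b B ?R, OF k assms(2) b R', folded c_def]
  show "summable (\<lambda>n. c (Suc n) * Wbar (Suc n) s B)"
    by (rule T(1))
  have "x j * indicat_real {s<..} (\<Sum>i=1..k. x i) * (\<Prod>i=1..k. me_density (b i) (R i) (x i)) =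
      me_mean (b j) (R j) * (indicat_real {s<..} (\<Sum>i=1..k. x i) * (\<Prod>i=1..k. me_density (b i) (?R i) (x i)))" for x
  proof -
    have "x j * (\<Prod>i=1..k. me_density (b i) (R i) (x i)) =
        x j * me_density (b j) (R j) (x j) * (\<Prod>i\<in>{1..k} - {j}. me_density (b i) (R i) (x i))"
      using assms(1) by (subst prod.remove[of _ j]) auto
    also have "x j * me_density (b j) (R j) (x j) = me_mean (b j) (R j) * me_density (b j) (?R j) (x j)"
      using b R mean assms(1) by (simp add: mult_me_density)
    also have "(\<Prod>i\<in>{1..k} - {j}. me_density (b i) (R i) (x i)) = (\<Prod>i\<in>{1..k} - {j}. me_density (b i) (?R i) (x i))"
      by (intro prod.cong) auto
    finally have "x j * (\<Prod>i=1..k. me_density (b i) (R i) (x i)) =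
        me_mean (b j) (R j) * (\<Prod>i=1..k. me_density (b i) (?R i) (x i))"
      using prod.remove[OF finite_atLeastAtMost assms(1), of "\<lambda>i. me_density (b i) (?R i) (x i)"]
      by (simp only: mult.assoc)
    then show ?thesis
      by (simp only: mult.assoc mult.left_commute[of _ "indicat_real {s<..} (\<Sum>i=1..k. x i)"])
  qed
  then show "has_bochner_integral (Pi\<^sub>M {1..k} (\<lambda>_. lborel))
      (\<lambda>x. x j * indicat_real {s<..} (\<Sum>i=1..k. x i) * (\<Prod>i=1..k. me_density (b i) (R i) (x i)))
      (me_mean (b j) (R j) * (\<Sum>n. c (Suc n) * Wbar (Suc n) s B))"
    using T(2) by (simp only: has_bochner_integral_mult_right)
qed

section \<open>Value at risk\<close>

text \<open>
\<open>LEAST\<close> denotes something only if the minimum exists. The superlevel set of the distribution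
function is nonempty because \<open>p < 1\<close>, bounded below by zero because \<open>0 < p\<close> and \<open>Z\<close> puts no mass on
the negative reals, and contains its infimum by right-continuity.
\<close>

lemma VaR_nonneg:
  assumes "prob_space M" and [measurable]: "Z \<in> borel_measurable M"
    and "AE \<omega> in M. 0 \<le> Z \<omega>" "0 < p" "p < 1"
  shows "0 \<le> VaR M Z p"
proof -
  interpret prob_space M by fact
  interpret Z: real_distribution "distr M borel Z" by (rule real_distribution_distr) simp
  let ?F = "cdf (distr M borel Z)"
  let ?A = "{x. p \<le> ?F x}"
  have nonneg: "0 \<le> x" if "x \<in> ?A" for x
  proof (rule ccontr)
    assume x: "\<not> 0 \<le> x"
    have "AE \<omega> in M. \<omega> \<notin> Z -` {..x} \<inter> space M"
      using assms(3) by (rule eventually_mono) (use x in auto)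
    then have "measure M (Z -` {..x} \<inter> space M) = 0"
      by (subst prob_eq_0) auto
    then show False
      using that assms(4) by (simp add: cdf_def measure_distr)
  qed
  have "\<forall>\<^sub>F x in at_top. p < ?F x"
    using order_tendstoD(1)[OF Z.cdf_lim_at_top_prob assms(5)] .
  then obtain x0 where "x0 \<in> ?A"
    by (metis (mono_tags, lifting) eventually_happens' less_imp_le mem_Collect_eq trivial_limit_at_top_linorder)
  then have ne: "?A \<noteq> {}" by auto
  have bdd: "bdd_below ?A" using nonneg by (intro bdd_belowI)
  have "p \<le> ?F (Inf ?A)"
  proof (rule tendsto_lowerbound)
    show "(?F \<longlongrightarrow> ?F (Inf ?A)) (at_right (Inf ?A))"
      using Z.cdf_is_right_cont by (simp add: continuous_within)
    show "\<forall>\<^sub>F x in at_right (Inf ?A). p \<le> ?F x"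
    proof (rule eventually_at_right_less[THEN eventually_mono])
      fix x assume "Inf ?A < x"
      then obtain y where "y \<in> ?A" "y < x" using cInf_less_iff[OF ne bdd] by blast
      then show "p \<le> ?F x" using Z.cdf_nondecreasing[of y x] by simp
    qed
  qed simp
  then have "VaR M Z p = Inf ?A"
    unfolding VaR_def using bdd by (intro Least_equality cInf_lower) auto
  then show ?thesis
    using cInf_greatest[OF ne nonneg] by simp
qed

section \<open>The Sarmanov density as a signed mixture\<close>

text \<open>
Scales and mixing vectors of the product density in which the factors with index in \<open>A\<close> have
been squared and renormalised. The sets that occur are \<open>{}\<close>, singletons and pairs, which treats the one- and two-index
transformations of the mixing vectors alike.
\<close>

definition tilted_scale :: "nat set \<Rightarrow> (nat \<Rightarrow> real) \<Rightarrow> nat \<Rightarrow> real" where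
  "tilted_scale A \<beta> i = (if i \<in> A then 2 * \<beta> i else \<beta> i)"

definition tilted_vector :: "nat set \<Rightarrow> (nat \<Rightarrow> nat \<Rightarrow> real) \<Rightarrow> nat \<Rightarrow> nat \<Rightarrow> real" where
  "tilted_vector A Q i = (if i \<in> A then V_trans (Q i) else Q i)"

lemma prod_tilted_me_density:
  assumes "A \<subseteq> {1..k}"
    and \<beta>: "\<And>i. i \<in> {1..k} \<Longrightarrow> 0 < \<beta> i"
    and Q: "\<And>i. i \<in> {1..k} \<Longrightarrow> mixing_vector (Q i)"
    and \<gamma>: "\<And>i. i \<in> {1..k} \<Longrightarrow> \<gamma> i = \<beta> i * square_norm (Q i)"
  shows "(\<Prod>i\<in>A. me_density (\<beta> i) (Q i) (x i)) * (\<Prod>i=1..k. me_density (\<beta> i) (Q i) (x i)) =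
    (\<Prod>i\<in>A. \<gamma> i) * (\<Prod>i=1..k. me_density (tilted_scale A \<beta> i) (tilted_vector A Q i) (x i))"
proof -
  let ?d = "\<lambda>i. me_density (\<beta> i) (Q i) (x i)"
  have A: "{1..k} \<inter> A = A" using assms(1) by auto
  have restrict: "(\<Prod>i\<in>A. g i) = (\<Prod>i=1..k. if i \<in> A then g i else 1)" for g :: "nat \<Rightarrow> real"
    using prod.inter_restrict[of "{1..k}" g A] unfolding A by simp
  show ?thesis
    unfolding restrict prod.distrib[symmetric]
    using \<beta> Q \<gamma> by (intro prod.cong) (auto simp: tilted_scale_def tilted_vector_def me_density_square)
qed

text \<open>
Multiplying out \<open>(f\<^sub>a - \<gamma>\<^sub>a) (f\<^sub>b - \<gamma>\<^sub>b)\<close> against the product of the marginal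
densities: every factor \<open>f\<^sub>i\<close> becomes \<open>\<gamma>\<^sub>i\<close> times a tilt at \<open>i\<close>, so all four terms carry
the same constant \<open>\<gamma>\<^sub>a \<gamma>\<^sub>b\<close>. The untilted terms of all pairs combine to \<open>xi\<close>.
\<close>

lemma sarmanov_density_eq_mixture:
  assumes \<beta>: "\<And>i. i \<in> {1..k} \<Longrightarrow> 0 < \<beta> i"
    and Q: "\<And>i. i \<in> {1..k} \<Longrightarrow> mixing_vector (Q i)"
    and \<gamma>: "\<And>i. i \<in> {1..k} \<Longrightarrow> \<gamma> i = \<beta> i * square_norm (Q i)"
  defines "D \<equiv> \<lambda>A x. \<Prod>i=1..k. me_density (tilted_scale A \<beta> i) (tilted_vector A Q i) (x i)"
  shows "sarmanov_density k \<beta> Q \<alpha> \<gamma> x = xi k \<alpha> \<gamma> * D {} x -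
    (\<Sum>(a, b)\<in>pairs k. \<alpha> a b * \<gamma> a * \<gamma> b * (D {b} x + D {a} x - D {a, b} x))"
proof -
  let ?d = "\<lambda>i. me_density (\<beta> i) (Q i) (x i)"
  let ?P = "\<Prod>i=1..k. ?d i"
  have D0: "D {} x = ?P"
    by (simp add: D_def tilted_scale_def tilted_vector_def)
  have pair: "\<alpha> a b * (?d a - \<gamma> a) * (?d b - \<gamma> b) * ?P =
      \<alpha> a b * \<gamma> a * \<gamma> b * ?P - \<alpha> a b * \<gamma> a * \<gamma> b * (D {b} x + D {a} x - D {a, b} x)"
    if "(a, b) \<in> pairs k" for a b
  proof -
    have ab: "a \<in> {1..k}" "b \<in> {1..k}" "a \<noteq> b"
      using that by (auto simp: pairs_def)
    have *: "(\<Prod>i\<in>A. ?d i) * ?P = (\<Prod>i\<in>A. \<gamma> i) * D A x" if "A \<subseteq> {1..k}" for A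
      unfolding D_def using that \<beta> Q \<gamma> by (rule prod_tilted_me_density)
    have a: "?d a * ?P = \<gamma> a * D {a} x" and b: "?d b * ?P = \<gamma> b * D {b} x"
      and c: "?d a * ?d b * ?P = \<gamma> a * \<gamma> b * D {a, b} x"
      using *[of "{a}"] *[of "{b}"] *[of "{a, b}"] ab by auto
    have "\<alpha> a b * (?d a - \<gamma> a) * (?d b - \<gamma> b) * ?P =
        \<alpha> a b * (?d a * ?d b * ?P - \<gamma> b * (?d a * ?P) - \<gamma> a * (?d b * ?P) + \<gamma> a * \<gamma> b * ?P)"
      by (simp add: algebra_simps)
    also have "\<dots> = \<alpha> a b * \<gamma> a * \<gamma> b * ?P - \<alpha> a b * \<gamma> a * \<gamma> b * (D {b} x + D {a} x - D {a, b} x)"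
      unfolding a b c by (simp add: algebra_simps)
    finally show ?thesis .
  qed
  have "sarmanov_density k \<beta> Q \<alpha> \<gamma> x =
      ?P + (\<Sum>(a, b)\<in>pairs k. \<alpha> a b * (?d a - \<gamma> a) * (?d b - \<gamma> b) * ?P)"
    unfolding sarmanov_density_def sarmanov_factor_def
    by (simp add: distrib_left sum_distrib_left split_beta mult_ac)
  also have "(\<Sum>(a, b)\<in>pairs k. \<alpha> a b * (?d a - \<gamma> a) * (?d b - \<gamma> b) * ?P) =
      (\<Sum>(a, b)\<in>pairs k. \<alpha> a b * \<gamma> a * \<gamma> b * ?P - \<alpha> a b * \<gamma> a * \<gamma> b * (D {b} x + D {a} x - D {a, b} x))"
    using pair by (intro sum.cong) auto
  also have "\<dots> = (\<Sum>(a, b)\<in>pairs k. \<alpha> a b * \<gamma> a * \<gamma> b) * ?P -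
      (\<Sum>(a, b)\<in>pairs k. \<alpha> a b * \<gamma> a * \<gamma> b * (D {b} x + D {a} x - D {a, b} x))"
    by (simp add: split_beta sum_subtractf sum_distrib_right)
  finally show ?thesis
    unfolding D0 xi_def by (simp add: algebra_simps)
qed

section \<open>Capital allocation\<close>

lemma SME_margins:
  assumes "prob_space M" "SME M k \<beta> Q \<alpha> X" "i \<in> {1..k}" "integrable M (X i)"
  shows "me_gamma M \<beta> Q X i = \<beta> i * square_norm (Q i)"
    and "summable (\<lambda>n. real (Suc n) * Q i (Suc n))"
    and "(\<integral>\<omega>. X i \<omega> \<partial>M) = me_mean (\<beta> i) (Q i)"
    and "AE \<omega> in M. 0 \<le> X i \<omega>"
proof -
  have \<beta>: "0 < \<beta> i" and Q: "mixing_vector (Q i)"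
    and dist: "distributed M lborel (X i) (\<lambda>x. ennreal (me_density (\<beta> i) (Q i) x))"
    using assms(2,3) unfolding SME_def by auto
  note nonneg = me_density_nonneg[OF \<beta> Q]
  show "me_gamma M \<beta> Q X i = \<beta> i * square_norm (Q i)"
    unfolding me_gamma_def integral_me_density_square[OF \<beta> Q, symmetric]
    by (rule distributed_integral[OF dist, symmetric]) (use nonneg in auto)
  have "(\<integral>\<^sup>+x. enn_me_density (\<beta> i) (Q i) x * ennreal x \<partial>lborel) = (\<integral>\<^sup>+\<omega>. ennreal (X i \<omega>) \<partial>M)"
    using distributed_nn_integral[OF dist, of ennreal] by (simp add: ennreal_me_density[OF \<beta> Q])
  also have "\<dots> \<le> (\<integral>\<^sup>+\<omega>. ennreal (norm (X i \<omega>)) \<partial>M)"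
    by (intro nn_integral_mono ennreal_leI) simp
  also have "\<dots> < \<top>"
    using assms(4) by (simp add: integrable_iff_bounded)
  finally show mean: "summable (\<lambda>n. real (Suc n) * Q i (Suc n))"
    unfolding summable_mean_iff[OF \<beta> Q] by simp
  show "(\<integral>\<omega>. X i \<omega> \<partial>M) = me_mean (\<beta> i) (Q i)"
    unfolding integral_mult_me_density[OF \<beta> Q mean, symmetric]
    by (rule distributed_integral[OF dist, symmetric]) (use nonneg in auto)
  show "AE \<omega> in M. 0 \<le> X i \<omega>"
  proof (rule AE_distrD[OF distributed_measurable[OF dist]])
    show "AE x in distr M lborel (X i). 0 \<le> x"
      unfolding distributed_distr_eq_density[OF dist]
      using me_density_neg[of _ "\<beta> i" "Q i"]
      by (subst AE_density) (auto intro!: AE_I2 simp: not_le[symmetric], fastforce)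
  qed
qed

text \<open>
Off the nonnegative orthant the Sarmanov factor may be negative, but there one of the marginal densities vanishes.
\<close>

lemma sarmanov_density_nonneg:
  assumes "SME M k \<beta> Q \<alpha> X"
  shows "0 \<le> sarmanov_density k \<beta> Q \<alpha> (me_gamma M \<beta> Q X) x"
proof (cases "\<forall>i\<in>{1..k}. 0 \<le> x i")
  case True
  then show ?thesis
    using assms unfolding SME_def sarmanov_density_def
    by (intro mult_nonneg_nonneg prod_nonneg ballI me_density_nonneg) auto
next
  case False
  then have "(\<Prod>i=1..k. me_density (\<beta> i) (Q i) (x i)) = 0"
    by (intro prod_zero) (auto intro: me_density_neg simp: not_le)
  then show ?thesis
    by (simp only: sarmanov_density_def mult_zero_left order_refl)
qed

text \<open>
Termwise integration of the mixture: tilting by \<open>A\<close> and size-biasing at \<open>j\<close> reproduces \<open>pi1\<close> for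
\<open>A = {}\<close> and \<open>pi2 k \<beta> Q j a b\<close> for \<open>A = {a, b}\<close>, and the mean of the \<open>j\<close>-th tilted component is \<open>phi2\<close>.
\<close>

lemma has_bochner_integral_sarmanov_allocation:
  fixes \<alpha> :: "nat \<Rightarrow> nat \<Rightarrow> real"
  assumes j: "j \<in> {1..k}" and s: "0 \<le> s"
    and \<beta>: "\<And>i. i \<in> {1..k} \<Longrightarrow> 0 < \<beta> i \<and> \<beta> i \<le> \<beta> k"
    and Q: "\<And>i. i \<in> {1..k} \<Longrightarrow> mixing_vector (Q i)"
    and mean: "summable (\<lambda>n. real (Suc n) * Q j (Suc n))"
    and \<gamma>: "\<And>i. i \<in> {1..k} \<Longrightarrow> \<gamma> i = \<beta> i * square_norm (Q i)"
    and \<mu>: "\<mu> j = me_mean (\<beta> j) (Q j)"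
  defines "T \<equiv> \<lambda>i. z_coeff k \<beta> Q \<alpha> \<gamma> \<mu> i j * Wbar i s (2 * \<beta> k)"
  shows "summable (\<lambda>n. T (Suc n))"
    and "has_bochner_integral (Pi\<^sub>M {1..k} (\<lambda>_. lborel))
      (\<lambda>x. sarmanov_density k \<beta> Q \<alpha> \<gamma> x * (x j * indicat_real {s<..} (\<Sum>i=1..k. x i))) (suminf1 T)"
proof -
  let ?N = "Pi\<^sub>M {1..k} (\<lambda>_::nat. lborel :: real measure)"
  let ?W = "\<lambda>n. Wbar (Suc n) s (2 * \<beta> k)"
  let ?h = "\<lambda>x. x j * indicat_real {s<..} (\<Sum>i=1..k. x i)"
  define D where "D = (\<lambda>A x. \<Prod>i=1..k. me_density (tilted_scale A \<beta> i) (tilted_vector A Q i) (x i))"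
  define m where "m = (\<lambda>A. me_mean (tilted_scale A \<beta> j) (tilted_vector A Q j))"
  define c where "c = (\<lambda>A. conv_coeff (\<lambda>n. Psi_trans (tilted_scale A \<beta> n) (2 * \<beta> k)
      (if n = j then G_trans (tilted_vector A Q n) else tilted_vector A Q n)) k)"
  define J where "J = (\<lambda>A. \<Sum>n. c A (Suc n) * ?W n)"
  have summable: "summable (\<lambda>n. c A (Suc n) * ?W n)"
    and int: "has_bochner_integral ?N (\<lambda>x. ?h x * D A x) (m A * J A)" for A
  proof -
    have *: "0 < tilted_scale A \<beta> i \<and> tilted_scale A \<beta> i \<le> 2 * \<beta> k" "mixing_vector (tilted_vector A Q i)"
      if "i \<in> {1..k}" for i
      using \<beta>[OF that] Q[OF that] mixing_vector_V_trans
      by (auto simp: tilted_scale_def tilted_vector_def)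
    have **: "summable (\<lambda>n. real (Suc n) * tilted_vector A Q j (Suc n))"
      using mean summable_mean_V_trans[OF Q[OF j] mean] unfolding tilted_vector_def by (cases "j \<in> A") simp_all
    show "summable (\<lambda>n. c A (Suc n) * ?W n)" "has_bochner_integral ?N (\<lambda>x. ?h x * D A x) (m A * J A)"
      unfolding c_def J_def m_def D_def
      by (rule tail_allocation_of_independent_me[where R = "tilted_vector A Q", OF j s * **]; assumption)+
  qed
  have J: "(\<lambda>n. c A (Suc n) * ?W n) sums J A" for A
    unfolding J_def using summable by (rule summable_sums)
  have m0: "\<mu> j = m {}" and c0: "pi1 k \<beta> Q j = c {}"
    by (simp_all add: \<mu> m_def c_def pi1_def M1_def fun_eq_iff tilted_scale_def tilted_vector_def cong: if_cong)
  have m2: "phi2 \<beta> Q \<mu> j a b = m {a, b}" for a b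
    by (simp add: \<mu> m_def phi2_def tilted_scale_def tilted_vector_def)
  have c2: "pi2 k \<beta> Q j a b = c {a, b}" for a b
  proof -
    have "M2 j a b Q n = (if n = j then G_trans (tilted_vector {a, b} Q n) else tilted_vector {a, b} Q n)" for n
      by (auto simp: M2_def tilted_vector_def)
    moreover have "M2_scale a b \<beta> n = tilted_scale {a, b} \<beta> n" for n
      by (simp add: M2_scale_def tilted_scale_def)
    ultimately show ?thesis
      unfolding c_def by (intro ext) (simp only: pi2_def)
  qed
  define L where "L = xi k \<alpha> \<gamma> * (m {} * J {}) -
    (\<Sum>(a, b)\<in>pairs k. \<alpha> a b * \<gamma> a * \<gamma> b * (m {b} * J {b} + m {a} * J {a} - m {a, b} * J {a, b}))"
  have sums: "(\<lambda>n. T (Suc n)) sums L"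
  proof -
    have "(\<lambda>n. xi k \<alpha> \<gamma> * (m {} * (c {} (Suc n) * ?W n)) -
      (\<Sum>(a, b)\<in>pairs k. \<alpha> a b * \<gamma> a * \<gamma> b * (m {b} * (c {b} (Suc n) * ?W n) + m {a} * (c {a} (Suc n) * ?W n)
         - m {a, b} * (c {a, b} (Suc n) * ?W n)))) sums L"
      unfolding L_def split_beta
      by (intro sums_diff sums_sum sums_mult sums_add J)
    moreover have "T (Suc n) = xi k \<alpha> \<gamma> * (m {} * (c {} (Suc n) * ?W n)) -
      (\<Sum>(a, b)\<in>pairs k. \<alpha> a b * \<gamma> a * \<gamma> b * (m {b} * (c {b} (Suc n) * ?W n) + m {a} * (c {a} (Suc n) * ?W n)
         - m {a, b} * (c {a, b} (Suc n) * ?W n)))" for n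
      unfolding T_def z_coeff_def m0 m2 c0 c2 left_diff_distrib sum_distrib_right
      by (simp add: split_beta algebra_simps)
    ultimately show ?thesis by simp
  qed
  then show "summable (\<lambda>n. T (Suc n))" by (rule sums_summable)
  have "has_bochner_integral ?N (\<lambda>x. xi k \<alpha> \<gamma> * (?h x * D {} x) -
      (\<Sum>(a, b)\<in>pairs k. \<alpha> a b * \<gamma> a * \<gamma> b * (?h x * D {b} x + ?h x * D {a} x - ?h x * D {a, b} x))) L"
    unfolding L_def split_beta
    by (intro has_bochner_integral_diff has_bochner_integral_sum has_bochner_integral_mult_right
        has_bochner_integral_add int)
  moreover have "sarmanov_density k \<beta> Q \<alpha> \<gamma> x * ?h x = xi k \<alpha> \<gamma> * (?h x * D {} x) -
      (\<Sum>(a, b)\<in>pairs k. \<alpha> a b * \<gamma> a * \<gamma> b * (?h x * D {b} x + ?h x * D {a} x - ?h x * D {a, b} x))" for x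
  proof -
    have "sarmanov_density k \<beta> Q \<alpha> \<gamma> x = xi k \<alpha> \<gamma> * D {} x -
        (\<Sum>(a, b)\<in>pairs k. \<alpha> a b * \<gamma> a * \<gamma> b * (D {b} x + D {a} x - D {a, b} x))"
      unfolding D_def using \<beta> Q \<gamma> by (intro sarmanov_density_eq_mixture) auto
    then show ?thesis
      by (simp only: left_diff_distrib sum_distrib_right) (simp add: split_beta algebra_simps)
  qed
  ultimately show "has_bochner_integral ?N (\<lambda>x. sarmanov_density k \<beta> Q \<alpha> \<gamma> x * ?h x) (suminf1 T)"
    using sums_unique[OF sums] by simp
qed

theorem proposition3p10:
  fixes M :: "'a measure"
    and k :: nat
    and \<beta> :: "nat \<Rightarrow> real"
    and Q :: "nat \<Rightarrow> nat \<Rightarrow> real"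
    and \<alpha> :: "nat \<Rightarrow> nat \<Rightarrow> real"
    and X :: "nat \<Rightarrow> 'a \<Rightarrow> real"
    and p :: real
  assumes "prob_space M"
    and "SME M k \<beta> Q \<alpha> X"
    and "\<And>j. j \<in> {1..k} \<Longrightarrow> \<beta> j \<le> \<beta> k"
    and "\<And>j. j \<in> {1..k} \<Longrightarrow> integrable M (X j)"
    and "0 < p" and "p < 1"
  shows
    "let \<gamma> = me_gamma M \<beta> Q X;
         \<mu> = (\<lambda>i. \<integral>\<omega>. X i \<omega> \<partial>M);
         s = VaR M (\<lambda>\<omega>. \<Sum>i=1..k. X i \<omega>) p;
         term = (\<lambda>j i. z_coeff k \<beta> Q \<alpha> \<gamma> \<mu> i j * Wbar i s (2 * \<beta> k))
     in (\<forall>i\<in>{1..k}. \<mu> i = me_mean (\<beta> i) (Q i)) \<and>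
        (\<forall>j\<in>{1..k}. summable (\<lambda>n. term j (Suc n)) \<and>
           tvar_allocation M k X p j = 1 / (1 - p) * suminf1 (term j))"
proof -
  note margins = SME_margins[OF assms(1,2) _ assms(4)]
  let ?S = "\<lambda>\<omega>. \<Sum>i=1..k. X i \<omega>"
  define \<gamma> where "\<gamma> = me_gamma M \<beta> Q X"
  define \<mu> where "\<mu> = (\<lambda>i. \<integral>\<omega>. X i \<omega> \<partial>M)"
  define s where "s = VaR M ?S p"
  define T where "T = (\<lambda>j i. z_coeff k \<beta> Q \<alpha> \<gamma> \<mu> i j * Wbar i s (2 * \<beta> k))"
  have \<beta>: "0 < \<beta> i \<and> \<beta> i \<le> \<beta> k" and Q: "mixing_vector (Q i)" if "i \<in> {1..k}" for i
    using assms(2,3) that unfolding SME_def by auto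
  have joint: "distributed M (Pi\<^sub>M {1..k} (\<lambda>_. lborel)) (\<lambda>\<omega>. \<lambda>i\<in>{1..k}. X i \<omega>)
      (\<lambda>x. ennreal (sarmanov_density k \<beta> Q \<alpha> \<gamma> x))"
    using assms(2) unfolding SME_def \<gamma>_def by blast
  have X: "X i \<in> borel_measurable M" if "i \<in> {1..k}" for i
    using assms(4)[OF that] by simp
  have s: "0 \<le> s"
    unfolding s_def
  proof (rule VaR_nonneg[OF assms(1) _ _ assms(5,6)])
    show "?S \<in> borel_measurable M"
      using X by (intro borel_measurable_sum)
    have "AE \<omega> in M. \<forall>i\<in>{1..k}. 0 \<le> X i \<omega>"
      using margins(4) by (intro AE_finite_allI) auto
    then show "AE \<omega> in M. 0 \<le> ?S \<omega>"
      by (rule eventually_mono) (auto intro: sum_nonneg)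
  qed
  have mean: "\<mu> i = me_mean (\<beta> i) (Q i)" if "i \<in> {1..k}" for i
    unfolding \<mu>_def using margins(3) that by blast
  have "summable (\<lambda>n. T j (Suc n)) \<and> tvar_allocation M k X p j = 1 / (1 - p) * suminf1 (T j)"
    if j: "j \<in> {1..k}" for j
  proof
    let ?h = "\<lambda>x. x j * indicat_real {s<..} (\<Sum>i=1..k. x i)"
    have \<gamma>: "\<gamma> i = \<beta> i * square_norm (Q i)" if "i \<in> {1..k}" for i
      unfolding \<gamma>_def using margins(1) that by blast
    note alloc = has_bochner_integral_sarmanov_allocation[where \<alpha> = \<alpha> and \<beta> = \<beta> and Q = Q and \<mu> = \<mu>,
      OF j s \<beta> Q margins(2)[OF j j] \<gamma> mean[OF j], folded T_def]
    show "summable (\<lambda>n. T j (Suc n))"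
      using alloc(1) unfolding T_def .
    have "(\<integral>\<omega>. X j \<omega> * indicat_real {\<omega> \<in> space M. ?S \<omega> > s} \<omega> \<partial>M) =
        (\<integral>\<omega>. ?h (\<lambda>i\<in>{1..k}. X i \<omega>) \<partial>M)"
      using j by (intro Bochner_Integration.integral_cong) (auto split: split_indicator)
    also have "\<dots> = (\<integral>x. sarmanov_density k \<beta> Q \<alpha> \<gamma> x * ?h x \<partial>Pi\<^sub>M {1..k} (\<lambda>_. lborel))"
    proof (rule distributed_integral[OF joint, symmetric])
      show "?h \<in> borel_measurable (Pi\<^sub>M {1..k} (\<lambda>_. lborel))"
        using j by measurable
      show "0 \<le> sarmanov_density k \<beta> Q \<alpha> \<gamma> x" for x
        unfolding \<gamma>_def by (rule sarmanov_density_nonneg[OF assms(2)])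
    qed
    also have "\<dots> = suminf1 (T j)"
      using alloc(2) unfolding T_def by (rule has_bochner_integral_integral_eq)
    finally show "tvar_allocation M k X p j = 1 / (1 - p) * suminf1 (T j)"
      unfolding tvar_allocation_def s_def by simp
  qed
  with mean show ?thesis
    unfolding Let_def T_def \<mu>_def s_def \<gamma>_def by blast
qed

end
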